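(* Let $J:\mathcal X\hookrightarrow\mathcal Y$ be the inclusion of a full coreflective subcategory, with right adjoint $E$ of $J$ and counit $\pi:JE\to{\rm Id}_{\mathcal Y}$. Let $T:\mathcal A^{\rm op}\to\mathcal X$, $S:\mathcal X\to\mathcal A^{\rm op}$ be a dual equivalence with natural isomorphisms $\eta:{\rm Id}_{\mathcal X}\to TS$, $\varepsilon:{\rm Id}_{\mathcal A}\to ST$ satisfying the triangular identities. Let $\mathcal B=\mathsf C(\mathcal A,\mathcal P_\pi,\mathcal X)$ and let $I:\mathcal A\to\mathcal B$ be the full embedding defined in the context. Then there is a dual equivalence $\tilde T:\mathcal B^{\rm op}\to\mathcal Y$, $\tilde S:\mathcal Y\to\mathcal B^{\rm op}$ with natural isomorphisms $\tilde\eta:{\rm Id}_{\mathcal Y}\to\tilde T\tilde S$, $\tilde\varepsilon:{\rm Id}_{\mathcal B}\to\tilde S\tilde T$ that is a right lifting of the given one along $I$ and $J$, i.e. $\tilde TI=JT$, and satisfies $$\tilde T\tilde S={\rm Id}_{\mathcal Y},\quad\tilde\eta=1_{{\rm Id}_{\mathcal Y}},\quad\tilde T\tilde\varepsilon=1_{\tilde T},\quad\tilde\varepsilon\tilde S=1_{\tilde S}.$$ Moreover, the full embedding $I$ has a reflector (left adjoint) $D\dashv I$ with unit $\rho:{\rm Id}_{\mathcal B}\to ID$ satisfying $DI={\rm Id}_{\mathcal A}$, $\rho I=1_I$ and $D\tilde S=SE$, so that the dual equivalence $(S,T,\eta,\varepsilon)$ is a left lifting of $(\tilde S,\tilde T,\tilde\eta,\tilde\varepsilon)$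 along $D$ and $E$. In addition to the canonical isomorphism $\gamma:IS\to\tilde SJ$, there is therefore the canonical isomorphism $\beta:E\tilde T\to TD$, determined by each of the conditions $\beta\tilde S=\eta E$ and $S\beta\circ\varepsilon D=D\tilde\varepsilon$; furthermore, $\beta$ and $\gamma$ connect $\pi$ and $\rho$ via $$\tilde T\rho\circ J\beta=\pi\tilde T,\qquad \gamma E\circ\rho\tilde S=\tilde S\pi.$$
   Context: Dual adjunctions. A dual adjunction between $\mathcal A$ and $\mathcal X$ consists of functors $T:\mathcal A^{\rm op}\to\mathcal X$, $S:\mathcal X\to\mathcal A^{\rm op}$ with $T$ right adjoint to $S$, given by natural transformations $\eta_X:X\to TSX$ in $\mathcal X$ and $\varepsilon_A:A\to STA$ in $\mathcal A$ with $T\varepsilon\circ\eta T=1_T$ and $S\eta\circ\varepsilon S=1_S$ ($T,S$ are treated as contravariant functors, op-notation being suppressed). It is a dual equivalence if $\eta,\varepsilon$ are isomorphisms. Given functors from the categories of one dual adjunction to those of another, the second is a right lifting of the first if the functors commute with the right adjoints ($T$-type functors) and a left lifting if they commute with the left adjoints ($S$-type functors). For the right lifting $\tilde TI=JT$, the canonical transformation is $\gamma=\tilde SJ\eta\circ\tilde\varepsilon IS:IS\to\tilde SJ$; it is the unique one with $\tilde T\gamma\circ\tilde\eta J=J\eta$. The class $\mathcal P_\pi$ consists of all morphisms $p=\pi_Y\circ\alpha:X\to Y$ of $\mathcal Y$, where $Y\in|\mathcal Y|$, $X\in|\mathcal X|$ and $\alpha:X\to EY$ is an isomorphism of $\mathcal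 X$. The category $\mathsf C(\mathcal A,\mathcal P_\pi,\mathcal X)$: objects are pairs $(A,p)$ with $A\in|\mathcal A|$ and $p:TA\to Y$ in $\mathcal P_\pi$; morphisms $(\varphi,f):(A,p:TA\to Y)\to(A',p':TA'\to Y')$ are pairs of $\varphi:A\to A'$ in $\mathcal A$ and $f:Y'\to Y$ in $\mathcal Y$ with $p\circ T\varphi=f\circ p'$; composition is $(\varphi',f')\circ(\varphi,f)=(\varphi'\circ\varphi,f\circ f')$. The full embedding $I:\mathcal A\to\mathcal B$ is $A\mapsto(A,1_{TA})$, $\varphi\mapsto(\varphi,T\varphi)$. *)

theory Defs
  imports Main
begin

text \<open>
  Categories carry explicit sets of objects and of arrows inside the types \<open>'o\<close> and \<open>'m\<close>;
  every arrow has a unique domain and codomain. \<open>Comp C g f\<close> is ``\<open>g\<close> after \<open>f\<close>''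
  and is meaningful only if \<open>Cod C f = Dom C g\<close>.
\<close>

record ('o, 'm) cat =
  Ob :: "'o set"
  Arr :: "'m set"
  Dom :: "'m \<Rightarrow> 'o"
  Cod :: "'m \<Rightarrow> 'o"
  Ide :: "'o \<Rightarrow> 'm"
  Comp :: "'m \<Rightarrow> 'm \<Rightarrow> 'm"

definition hom :: "('o, 'm) cat \<Rightarrow> 'o \<Rightarrow> 'o \<Rightarrow> 'm set" where
  "hom C a b = {f \<in> Arr C. Dom C f = a \<and> Cod C f = b}"

locale category =
  fixes C :: "('o, 'm) cat"
  assumes dom_ob: "f \<in> Arr C \<Longrightarrow> Dom C f \<in> Ob C"
    and cod_ob: "f \<in> Arr C \<Longrightarrow> Cod C f \<in> Ob C"
    and ide_hom: "a \<in> Ob C \<Longrightarrow> Ide C a \<in> hom C a a"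
    and comp_hom: "f \<in> hom C a b \<Longrightarrow> g \<in> hom C b c \<Longrightarrow> Comp C g f \<in> hom C a c"
    and comp_ide_right: "f \<in> hom C a b \<Longrightarrow> Comp C f (Ide C a) = f"
    and comp_ide_left: "f \<in> hom C a b \<Longrightarrow> Comp C (Ide C b) f = f"
    and comp_assoc: "f \<in> hom C a b \<Longrightarrow> g \<in> hom C b c \<Longrightarrow> h \<in> hom C c d \<Longrightarrow>
      Comp C h (Comp C g f) = Comp C (Comp C h g) f"

definition op :: "('o, 'm) cat \<Rightarrow> ('o, 'm) cat" where
  "op C = \<lparr>Ob = Ob C, Arr = Arr C, Dom = Cod C, Cod = Dom C, Ide = Ide C,
           Comp = (\<lambda>g f. Comp C f g)\<rparr>"

definition is_iso :: "('o, 'm) cat \<Rightarrow> 'm \<Rightarrow> bool" where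
  "is_iso C f \<longleftrightarrow> f \<in> Arr C \<and>
     (\<exists>g \<in> hom C (Cod C f) (Dom C f).
        Comp C g f = Ide C (Dom C f) \<and> Comp C f g = Ide C (Cod C f))"

definition full_subcategory :: "('o, 'm) cat \<Rightarrow> ('o, 'm) cat \<Rightarrow> bool" where
  "full_subcategory X Y \<longleftrightarrow>
     category X \<and> category Y \<and> Ob X \<subseteq> Ob Y \<and>
     Arr X = {f \<in> Arr Y. Dom Y f \<in> Ob X \<and> Cod Y f \<in> Ob X} \<and>
     (\<forall>f \<in> Arr X. Dom X f = Dom Y f \<and> Cod X f = Cod Y f) \<and>
     (\<forall>x \<in> Ob X. Ide X x = Ide Y x) \<and>
     (\<forall>f \<in> Arr X. \<forall>g \<in> Arr X. Cod X f = Dom X g \<longrightarrow> Comp X g f = Comp Y g f)"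

text \<open>
  A functor is represented by its object and arrow maps only; source and target categories are
  arguments of the predicate \<open>is_functor\<close>. Hence a contravariant functor is a functor on \<open>op C\<close>,
  two contravariant functors compose to a covariant one, and equality of functors means agreement
  of the maps on the objects and arrows of the source.
\<close>

record ('o, 'm, 'p, 'n) ftor =
  fobj :: "'o \<Rightarrow> 'p"
  farr :: "'m \<Rightarrow> 'n"

definition is_functor ::
    "('o, 'm) cat \<Rightarrow> ('p, 'n) cat \<Rightarrow> ('o, 'm, 'p, 'n) ftor \<Rightarrow> bool" where
  "is_functor C D F \<longleftrightarrow>
     category C \<and> category D \<and>
     (\<forall>a \<in> Ob C. fobj F a \<in> Ob D) \<and>
     (\<forall>f \<in> Arr C. farr F f \<in> hom D (fobj F (Dom C f)) (fobj F (Cod C f))) \<and>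
     (\<forall>a \<in> Ob C. farr F (Ide C a) = Ide D (fobj F a)) \<and>
     (\<forall>f \<in> Arr C. \<forall>g \<in> Arr C. Cod C f = Dom C g \<longrightarrow>
        farr F (Comp C g f) = Comp D (farr F g) (farr F f))"

definition functor_eq ::
    "('o, 'm) cat \<Rightarrow> ('o, 'm, 'p, 'n) ftor \<Rightarrow> ('o, 'm, 'p, 'n) ftor \<Rightarrow> bool" where
  "functor_eq C F G \<longleftrightarrow>
     (\<forall>a \<in> Ob C. fobj F a = fobj G a) \<and> (\<forall>f \<in> Arr C. farr F f = farr G f)"

definition fcomp ::
    "('p, 'n, 'q, 'l) ftor \<Rightarrow> ('o, 'm, 'p, 'n) ftor \<Rightarrow> ('o, 'm, 'q, 'l) ftor"
    (infixr "\<cdot>" 75) where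
  "G \<cdot> F = \<lparr>fobj = (\<lambda>a. fobj G (fobj F a)), farr = (\<lambda>f. farr G (farr F f))\<rparr>"

definition id_functor :: "('o, 'm, 'o, 'm) ftor" where
  "id_functor = \<lparr>fobj = (\<lambda>a. a), farr = (\<lambda>f. f)\<rparr>"

definition inclusion_functor :: "('o, 'm, 'o, 'm) ftor" where
  "inclusion_functor = \<lparr>fobj = (\<lambda>a. a), farr = (\<lambda>f. f)\<rparr>"

definition full_embedding ::
    "('o, 'm) cat \<Rightarrow> ('p, 'n) cat \<Rightarrow> ('o, 'm, 'p, 'n) ftor \<Rightarrow> bool" where
  "full_embedding C D F \<longleftrightarrow>
     is_functor C D F \<and> inj_on (fobj F) (Ob C) \<and>
     (\<forall>a \<in> Ob C. \<forall>b \<in> Ob C. bij_betw (farr F) (hom C a b) (hom D (fobj F a) (fobj F b)))"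

definition nat_trans ::
    "('o, 'm) cat \<Rightarrow> ('p, 'n) cat \<Rightarrow> ('o, 'm, 'p, 'n) ftor \<Rightarrow> ('o, 'm, 'p, 'n) ftor
       \<Rightarrow> ('o \<Rightarrow> 'n) \<Rightarrow> bool" where
  "nat_trans C D F G \<tau> \<longleftrightarrow>
     is_functor C D F \<and> is_functor C D G \<and>
     (\<forall>a \<in> Ob C. \<tau> a \<in> hom D (fobj F a) (fobj G a)) \<and>
     (\<forall>f \<in> Arr C. Comp D (farr G f) (\<tau> (Dom C f)) = Comp D (\<tau> (Cod C f)) (farr F f))"

definition nat_iso ::
    "('o, 'm) cat \<Rightarrow> ('p, 'n) cat \<Rightarrow> ('o, 'm, 'p, 'n) ftor \<Rightarrow> ('o, 'm, 'p, 'n) ftor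
       \<Rightarrow> ('o \<Rightarrow> 'n) \<Rightarrow> bool" where
  "nat_iso C D F G \<tau> \<longleftrightarrow> nat_trans C D F G \<tau> \<and> (\<forall>a \<in> Ob C. is_iso D (\<tau> a))"

definition adjunction ::
    "('o, 'm) cat \<Rightarrow> ('p, 'n) cat \<Rightarrow> ('o, 'm, 'p, 'n) ftor \<Rightarrow> ('p, 'n, 'o, 'm) ftor
       \<Rightarrow> ('o \<Rightarrow> 'm) \<Rightarrow> ('p \<Rightarrow> 'n) \<Rightarrow> bool" where
  "adjunction C D F G u c \<longleftrightarrow>
     is_functor C D F \<and> is_functor D C G \<and>
     nat_trans C C id_functor (G \<cdot> F) u \<and> nat_trans D D (F \<cdot> G) id_functor c \<and>
     (\<forall>a \<in> Ob C. Comp D (c (fobj F a)) (farr F (u a)) = Ide D (fobj F a)) \<and>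
     (\<forall>b \<in> Ob D. Comp C (farr G (c b)) (u (fobj G b)) = Ide C (fobj G b))"

definition adjoint_with_unit ::
    "('o, 'm) cat \<Rightarrow> ('p, 'n) cat \<Rightarrow> ('o, 'm, 'p, 'n) ftor \<Rightarrow> ('p, 'n, 'o, 'm) ftor
       \<Rightarrow> ('o \<Rightarrow> 'm) \<Rightarrow> bool" where
  "adjoint_with_unit C D F G u \<longleftrightarrow> (\<exists>c. adjunction C D F G u c)"

definition adjoint_with_counit ::
    "('o, 'm) cat \<Rightarrow> ('p, 'n) cat \<Rightarrow> ('o, 'm, 'p, 'n) ftor \<Rightarrow> ('p, 'n, 'o, 'm) ftor
       \<Rightarrow> ('p \<Rightarrow> 'n) \<Rightarrow> bool" where
  "adjoint_with_counit C D F G c \<longleftrightarrow> (\<exists>u. adjunction C D F G u c)"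

text \<open>
  In \<open>dual_adjunction A X T S \<eta> \<epsilon>\<close> both \<open>\<eta>\<close> and \<open>\<epsilon>\<close> are of unit type, with components in \<open>X\<close>
  and in \<open>A\<close> (not in \<open>op A\<close>), and the last two conditions are
  \<open>T\<epsilon> \<circ> \<eta>T = 1\<close> in \<open>X\<close> and \<open>S\<eta> \<circ> \<epsilon>S = 1\<close> in \<open>A\<close>.
\<close>

definition dual_adjunction ::
    "('a, 'm) cat \<Rightarrow> ('x, 'n) cat \<Rightarrow> ('a, 'm, 'x, 'n) ftor \<Rightarrow> ('x, 'n, 'a, 'm) ftor
       \<Rightarrow> ('x \<Rightarrow> 'n) \<Rightarrow> ('a \<Rightarrow> 'm) \<Rightarrow> bool" where
  "dual_adjunction A X T S \<eta> \<epsilon> \<longleftrightarrow>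
     is_functor (op A) X T \<and> is_functor X (op A) S \<and>
     nat_trans X X id_functor (T \<cdot> S) \<eta> \<and> nat_trans A A id_functor (S \<cdot> T) \<epsilon> \<and>
     (\<forall>a \<in> Ob A. Comp X (farr T (\<epsilon> a)) (\<eta> (fobj T a)) = Ide X (fobj T a)) \<and>
     (\<forall>x \<in> Ob X. Comp A (farr S (\<eta> x)) (\<epsilon> (fobj S x)) = Ide A (fobj S x))"

definition dual_equivalence ::
    "('a, 'm) cat \<Rightarrow> ('x, 'n) cat \<Rightarrow> ('a, 'm, 'x, 'n) ftor \<Rightarrow> ('x, 'n, 'a, 'm) ftor
       \<Rightarrow> ('x \<Rightarrow> 'n) \<Rightarrow> ('a \<Rightarrow> 'm) \<Rightarrow> bool" where
  "dual_equivalence A X T S \<eta> \<epsilon> \<longleftrightarrow>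
     dual_adjunction A X T S \<eta> \<epsilon> \<and>
     nat_iso X X id_functor (T \<cdot> S) \<eta> \<and> nat_iso A A id_functor (S \<cdot> T) \<epsilon>"

text \<open>
  Liftings from a dual adjunction between \<open>A\<close> and \<open>X\<close> to one between \<open>B\<close> and \<open>Y\<close>, along
  \<open>I : A \<rightarrow> B\<close> and \<open>J : X \<rightarrow> Y\<close>: the primed functors are those of the second adjunction.
\<close>

definition right_lifting ::
    "('a, 'k) cat \<Rightarrow> ('x, 'l) cat \<Rightarrow> ('a, 'k, 'x, 'l) ftor \<Rightarrow>
     ('b, 'm) cat \<Rightarrow> ('y, 'n) cat \<Rightarrow> ('b, 'm, 'y, 'n) ftor \<Rightarrow>
     ('a, 'k, 'b, 'm) ftor \<Rightarrow> ('x, 'l, 'y, 'n) ftor \<Rightarrow> bool" where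
  "right_lifting A X T B Y T' I J \<longleftrightarrow>
     is_functor A B I \<and> is_functor X Y J \<and> functor_eq A (T' \<cdot> I) (J \<cdot> T)"

definition left_lifting ::
    "('a, 'k) cat \<Rightarrow> ('x, 'l) cat \<Rightarrow> ('x, 'l, 'a, 'k) ftor \<Rightarrow>
     ('b, 'm) cat \<Rightarrow> ('y, 'n) cat \<Rightarrow> ('y, 'n, 'b, 'm) ftor \<Rightarrow>
     ('a, 'k, 'b, 'm) ftor \<Rightarrow> ('x, 'l, 'y, 'n) ftor \<Rightarrow> bool" where
  "left_lifting A X S B Y S' I J \<longleftrightarrow>
     is_functor A B I \<and> is_functor X Y J \<and> functor_eq X (S' \<cdot> J) (I \<cdot> S)"

text \<open>
  The canonical transformations \<open>S'J\<eta> \<circ> \<epsilon>'IS : IS \<rightarrow> S'J\<close> of a right lifting (\<open>T'I = JT\<close>)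
  and, dually, \<open>T'I\<epsilon> \<circ> \<eta>'JT : JT \<rightarrow> T'I\<close> of a left lifting (\<open>S'J = IS\<close>).
\<close>

definition canonical_right ::
    "('b, 'm) cat \<Rightarrow> ('a, 'k, 'b, 'm) ftor \<Rightarrow> ('x, 'l, 'y, 'n) ftor \<Rightarrow>
     ('x, 'l, 'a, 'k) ftor \<Rightarrow> ('x \<Rightarrow> 'l) \<Rightarrow> ('y, 'n, 'b, 'm) ftor \<Rightarrow> ('b \<Rightarrow> 'm) \<Rightarrow> 'x \<Rightarrow> 'm" where
  "canonical_right B I J S \<eta> S' \<epsilon>' x =
     Comp B (farr S' (farr J (\<eta> x))) (\<epsilon>' (fobj I (fobj S x)))"

definition canonical_left ::
    "('y, 'n) cat \<Rightarrow> ('a, 'k, 'b, 'm) ftor \<Rightarrow> ('x, 'l, 'y, 'n) ftor \<Rightarrow>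
     ('a, 'k, 'x, 'l) ftor \<Rightarrow> ('a \<Rightarrow> 'k) \<Rightarrow> ('b, 'm, 'y, 'n) ftor \<Rightarrow> ('y \<Rightarrow> 'n) \<Rightarrow> 'a \<Rightarrow> 'n" where
  "canonical_left Y I J T \<epsilon> T' \<eta>' a =
     Comp Y (farr T' (farr I (\<epsilon> a))) (\<eta>' (fobj J (fobj T a)))"

definition P_class ::
    "('y, 'n) cat \<Rightarrow> ('y, 'n) cat \<Rightarrow> ('y, 'n, 'y, 'n) ftor \<Rightarrow> ('y \<Rightarrow> 'n) \<Rightarrow> 'n set" where
  "P_class X Y E \<pi> =
     {Comp Y (\<pi> y) \<alpha> | y \<alpha>. y \<in> Ob Y \<and> is_iso X \<alpha> \<and> Cod X \<alpha> = fobj E y}"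

text \<open>
  The target of \<open>p\<close> in an object \<open>(a, p)\<close> of \<open>cat_C A Y T P\<close> is \<open>Cod Y p\<close>. Since a pair
  \<open>(\<phi>, f)\<close> may be a morphism between different pairs of objects, arrows are triples
  consisting of the source, the pair \<open>(\<phi>, f)\<close> and the target.
\<close>

type_synonym ('a, 'k, 'n) c_arr = "('a \<times> 'n) \<times> ('k \<times> 'n) \<times> ('a \<times> 'n)"

definition cat_C_obj ::
    "('a, 'k) cat \<Rightarrow> ('y, 'n) cat \<Rightarrow> ('a, 'k, 'y, 'n) ftor \<Rightarrow> 'n set \<Rightarrow> ('a \<times> 'n) set" where
  "cat_C_obj A Y T P = {(a, p). a \<in> Ob A \<and> p \<in> P \<and> Dom Y p = fobj T a}"

definition cat_C ::
    "('a, 'k) cat \<Rightarrow> ('y, 'n) cat \<Rightarrow> ('a, 'k, 'y, 'n) ftor \<Rightarrow> 'n set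
       \<Rightarrow> ('a \<times> 'n, ('a, 'k, 'n) c_arr) cat" where
  "cat_C A Y T P =
     \<lparr>Ob = cat_C_obj A Y T P,
      Arr = {((a, p), (\<phi>, f), (a', p')).
        (a, p) \<in> cat_C_obj A Y T P \<and> (a', p') \<in> cat_C_obj A Y T P \<and>
        \<phi> \<in> hom A a a' \<and> f \<in> hom Y (Cod Y p') (Cod Y p) \<and>
        Comp Y p (farr T \<phi>) = Comp Y f p'},
      Dom = (\<lambda>(b, _, _). b),
      Cod = (\<lambda>(_, _, b'). b'),
      Ide = (\<lambda>(a, p). ((a, p), (Ide A a, Ide Y (Cod Y p)), (a, p))),
      Comp = (\<lambda>(_, (\<phi>', f'), b'') (b, (\<phi>, f), _). (b, (Comp A \<phi>' \<phi>, Comp Y f f'), b''))\<rparr>"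

definition embedding_C ::
    "('a, 'k) cat \<Rightarrow> ('y, 'n) cat \<Rightarrow> ('a, 'k, 'y, 'n) ftor
       \<Rightarrow> ('a, 'k, 'a \<times> 'n, ('a, 'k, 'n) c_arr) ftor" where
  "embedding_C A Y T =
     \<lparr>fobj = (\<lambda>a. (a, Ide Y (fobj T a))),
      farr = (\<lambda>\<phi>. ((Dom A \<phi>, Ide Y (fobj T (Dom A \<phi>))), (\<phi>, farr T \<phi>),
                     (Cod A \<phi>, Ide Y (fobj T (Cod A \<phi>)))))\<rparr>"

end

theory Submission
  imports Defs
begin

text \<open>
  The whole result rests on one observation: the forgetful functor \<open>T' : (A, p) \<mapsto> Cod p\<close>,
  \<open>(\<phi>, f) \<mapsto> f\<close> from \<open>B\<close> to \<open>Y\<close> is (contravariantly) fully faithful. A morphism \<open>p\<close> of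
  \<open>P\<^sub>\<pi>\<close> is a coreflection of its codomain, up to an isomorphism of its domain; so an arrow \<open>f\<close> between
  codomains lifts uniquely to an arrow of \<open>X\<close> between the domains \<open>TA'\<close> and \<open>TA\<close>
  (lemmas \<open>P_factor\<close> and \<open>P_cancel\<close>), and this arrow is \<open>T\<phi>\<close> for a unique \<open>\<phi>\<close>, because \<open>T\<close>,
  as half of a dual equivalence, is fully faithful (lemmas \<open>T_full\<close> and \<open>T_faithful\<close>).

  Moreover \<open>T'\<close> has a strict section. Let \<open>S'y = (SEy, p\<^sub>y)\<close>, where \<open>p\<^sub>y : TSEy \<rightarrow> y\<close> is the arrow
  with \<open>p\<^sub>y \<circ> \<eta>\<^bsub>Ey\<^esub> = \<pi>\<^sub>y\<close>, and \<open>S'f = (SEf, f)\<close>. Then \<open>T'S'\<close> is the identity, and the unit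
  \<open>\<epsilon>'\<close> at \<open>b\<close> is the unique arrow \<open>b \<rightarrow> S'T'b\<close> that \<open>T'\<close> sends to an identity.
  Faithfulness of \<open>T'\<close> then reduces functoriality of \<open>S'\<close>, naturality of \<open>\<epsilon>'\<close>, the identity
  \<open>\<epsilon>'S' = 1\<close> and the identities for \<open>\<gamma>\<close> to equations in \<open>Y\<close>, and
  fullness makes \<open>T'\<close> reflect isomorphisms, so that \<open>\<epsilon>'\<close> and \<open>\<gamma>\<close>, whose images are \<open>1\<close> and
  \<open>\<eta>\<close>, are isomorphisms.

  The reflector is the other forgetful functor, \<open>D : (A, p) \<mapsto> A\<close>, with unit
  \<open>\<rho>\<^bsub>(A, p)\<^esub> = (1, p) : (A, p) \<rightarrow> (A, 1)\<close>. Finally \<open>\<beta>\<close> at \<open>(A, p)\<close> is the comparison of the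
  coreflection \<open>\<pi>\<close> with \<open>p\<close>, that is \<open>p \<circ> \<beta> = \<pi>\<close>. This is the identity \<open>T'\<rho> \<circ> J\<beta> = \<pi>T'\<close>, and
  since \<open>p\<close> can be cancelled it also gives naturality and invertibility of \<open>\<beta>\<close>. The condition
  \<open>\<beta>S' = \<eta>E\<close> determines \<open>\<beta>\<close> by naturality along the arrows \<open>\<epsilon>'\<close>, on which \<open>ET'\<close> is the
  identity; the condition \<open>S\<beta> \<circ> \<epsilon>D = D\<epsilon>'\<close> says that \<open>\<beta>\<close> and \<open>D\<epsilon>'\<close> are transposes under the
  given dual adjunction.
\<close>

section \<open>Categories, functors and natural isomorphisms\<close>

lemma op_simps [simp]:
  "Ob (op C) = Ob C" "Arr (op C) = Arr C" "Dom (op C) = Cod C" "Cod (op C) = Dom C"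
  "Ide (op C) = Ide C" "Comp (op C) g f = Comp C f g" "hom (op C) a b = hom C b a"
  by (auto simp: op_def hom_def)

lemma op_op [simp]: "op (op C) = C"
  by (simp add: op_def)

lemma homD:
  assumes "f \<in> hom C a b"
  shows "f \<in> Arr C" "Dom C f = a" "Cod C f = b"
  using assms by (auto simp: hom_def)

lemma Arr_hom: "f \<in> Arr C \<Longrightarrow> f \<in> hom C (Dom C f) (Cod C f)"
  by (simp add: hom_def)

lemma (in category) hom_ob:
  assumes "f \<in> hom C a b"
  shows "a \<in> Ob C" "b \<in> Ob C"
  using assms dom_ob cod_ob by (auto simp: hom_def)

lemma (in category) category_op: "category (op C)"
  by unfold_locales (auto simp: comp_ide_left comp_ide_right comp_assoc ide_hom
      intro: comp_hom dom_ob cod_ob)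

lemma category_op_iff [simp]: "category (op C) \<longleftrightarrow> category C"
  using category.category_op[of C] category.category_op[of "op C"] by auto

lemma is_functor_op_iff [simp]: "is_functor (op C) (op D) F \<longleftrightarrow> is_functor C D F"
  by (auto simp: is_functor_def)

lemma is_functor_op_shift: "is_functor C (op D) F \<longleftrightarrow> is_functor (op C) D F"
  using is_functor_op_iff[of "op C" D F] by simp

lemma is_functorD:
  assumes "is_functor C D F"
  shows "category C" "category D"
    and "a \<in> Ob C \<Longrightarrow> fobj F a \<in> Ob D"
    and "f \<in> hom C a b \<Longrightarrow> farr F f \<in> hom D (fobj F a) (fobj F b)"
    and "a \<in> Ob C \<Longrightarrow> farr F (Ide C a) = Ide D (fobj F a)"
    and "f \<in> hom C a b \<Longrightarrow> g \<in> hom C b c \<Longrightarrow>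
      farr F (Comp C g f) = Comp D (farr F g) (farr F f)"
  using assms by (auto simp: is_functor_def hom_def)

lemma is_functorI:
  assumes "category C" "category D"
    and "\<And>a. a \<in> Ob C \<Longrightarrow> fobj F a \<in> Ob D"
    and "\<And>f a b. f \<in> hom C a b \<Longrightarrow> farr F f \<in> hom D (fobj F a) (fobj F b)"
    and "\<And>a. a \<in> Ob C \<Longrightarrow> farr F (Ide C a) = Ide D (fobj F a)"
    and "\<And>f g a b c. f \<in> hom C a b \<Longrightarrow> g \<in> hom C b c \<Longrightarrow>
      farr F (Comp C g f) = Comp D (farr F g) (farr F f)"
  shows "is_functor C D F"
  unfolding is_functor_def using assms by (metis Arr_hom)

lemma fcomp_simps [simp]:
  "fobj (G \<cdot> F) a = fobj G (fobj F a)" "farr (G \<cdot> F) f = farr G (farr F f)"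
  by (auto simp: fcomp_def)

lemma id_functor_simps [simp]: "fobj id_functor a = a" "farr id_functor f = f"
  by (auto simp: id_functor_def)

lemma inclusion_functor_simps [simp]:
  "fobj inclusion_functor a = a" "farr inclusion_functor f = f"
  by (auto simp: inclusion_functor_def)

lemma is_functor_fcomp:
  assumes F: "is_functor C D F" and G: "is_functor D H G"
  shows "is_functor C H (G \<cdot> F)"
  by (rule is_functorI)
    (auto simp: is_functorD(3,5)[OF F] is_functorD(3,5)[OF G]
      is_functorD(6)[OF F] is_functorD(6)[OF G is_functorD(4)[OF F] is_functorD(4)[OF F]]
      intro: is_functorD(1)[OF F] is_functorD(2)[OF G] is_functorD(4)[OF F] is_functorD(4)[OF G])

lemma is_functor_id: "category C \<Longrightarrow> is_functor C C id_functor"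
  by (rule is_functorI) auto

lemma nat_transD:
  assumes "nat_trans C D F G \<tau>"
  shows "a \<in> Ob C \<Longrightarrow> \<tau> a \<in> hom D (fobj F a) (fobj G a)"
    and "f \<in> hom C a b \<Longrightarrow> Comp D (farr G f) (\<tau> a) = Comp D (\<tau> b) (farr F f)"
  using assms by (auto simp: nat_trans_def hom_def)

lemma nat_transI:
  assumes "is_functor C D F" "is_functor C D G"
    and "\<And>a. a \<in> Ob C \<Longrightarrow> \<tau> a \<in> hom D (fobj F a) (fobj G a)"
    and "\<And>f a b. f \<in> hom C a b \<Longrightarrow> Comp D (farr G f) (\<tau> a) = Comp D (\<tau> b) (farr F f)"
  shows "nat_trans C D F G \<tau>"
  unfolding nat_trans_def using assms by (metis Arr_hom)

lemma is_isoI: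
  assumes "f \<in> hom C a b" "g \<in> hom C b a" "Comp C g f = Ide C a" "Comp C f g = Ide C b"
  shows "is_iso C f"
  using assms by (auto simp: is_iso_def hom_def)

lemma is_isoE:
  assumes "is_iso C f" "f \<in> hom C a b"
  obtains g where "g \<in> hom C b a" "Comp C g f = Ide C a" "Comp C f g = Ide C b"
  using assms by (auto simp: is_iso_def hom_def)

section \<open>Dual equivalences\<close>

locale dual_equiv = cA: category A + cX: category X
  for A :: "('a, 'k) cat" and X :: "('x, 'n) cat" +
  fixes T :: "('a, 'k, 'x, 'n) ftor" and S :: "('x, 'n, 'a, 'k) ftor"
    and \<eta> :: "'x \<Rightarrow> 'n" and \<epsilon> :: "'a \<Rightarrow> 'k"
  assumes dual_equivalence: "dual_equivalence A X T S \<eta> \<epsilon>"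
begin

lemma T_functor: "is_functor (op A) X T" and S_functor: "is_functor X (op A) S"
  using dual_equivalence by (auto simp: dual_equivalence_def dual_adjunction_def)

lemma T_ob: "a \<in> Ob A \<Longrightarrow> fobj T a \<in> Ob X"
  and T_hom: "\<phi> \<in> hom A a b \<Longrightarrow> farr T \<phi> \<in> hom X (fobj T b) (fobj T a)"
  and T_ide: "a \<in> Ob A \<Longrightarrow> farr T (Ide A a) = Ide X (fobj T a)"
  and T_comp: "\<phi> \<in> hom A a b \<Longrightarrow> \<psi> \<in> hom A b c \<Longrightarrow>
    farr T (Comp A \<psi> \<phi>) = Comp X (farr T \<phi>) (farr T \<psi>)"
  using is_functorD(3-6)[OF T_functor] by auto

lemma S_ob: "x \<in> Ob X \<Longrightarrow> fobj S x \<in> Ob A"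
  and S_hom: "f \<in> hom X x y \<Longrightarrow> farr S f \<in> hom A (fobj S y) (fobj S x)"
  and S_comp: "f \<in> hom X x y \<Longrightarrow> g \<in> hom X y z \<Longrightarrow>
    farr S (Comp X g f) = Comp A (farr S f) (farr S g)"
  using is_functorD(3,4,6)[OF S_functor] by auto

lemma \<eta>_nat: "nat_trans X X id_functor (T \<cdot> S) \<eta>"
  and \<epsilon>_nat: "nat_trans A A id_functor (S \<cdot> T) \<epsilon>"
  using dual_equivalence by (auto simp: dual_equivalence_def dual_adjunction_def)

lemma \<eta>_hom: "x \<in> Ob X \<Longrightarrow> \<eta> x \<in> hom X x (fobj T (fobj S x))"
  and \<epsilon>_hom: "a \<in> Ob A \<Longrightarrow> \<epsilon> a \<in> hom A a (fobj S (fobj T a))"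
  and \<eta>_natural: "f \<in> hom X x y \<Longrightarrow> Comp X (farr T (farr S f)) (\<eta> x) = Comp X (\<eta> y) f"
  and \<epsilon>_natural: "\<phi> \<in> hom A a b \<Longrightarrow> Comp A (farr S (farr T \<phi>)) (\<epsilon> a) = Comp A (\<epsilon> b) \<phi>"
  using nat_transD[OF \<eta>_nat] nat_transD[OF \<epsilon>_nat] by auto

lemma \<eta>_iso: "x \<in> Ob X \<Longrightarrow> is_iso X (\<eta> x)" and \<epsilon>_iso: "a \<in> Ob A \<Longrightarrow> is_iso A (\<epsilon> a)"
  using dual_equivalence by (auto simp: dual_equivalence_def nat_iso_def)

lemma triangle_T: "a \<in> Ob A \<Longrightarrow> Comp X (farr T (\<epsilon> a)) (\<eta> (fobj T a)) = Ide X (fobj T a)"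
  and triangle_S: "x \<in> Ob X \<Longrightarrow> Comp A (farr S (\<eta> x)) (\<epsilon> (fobj S x)) = Ide A (fobj S x)"
  using dual_equivalence by (auto simp: dual_equivalence_def dual_adjunction_def)

text \<open>
  This lemma and \<open>transpose_right\<close> say that transposing along \<open>\<epsilon>\<close> and along \<open>\<eta>\<close> are mutually
  inverse: arrows \<open>x \<rightarrow> Ta\<close> correspond to arrows \<open>a \<rightarrow> Sx\<close>. Each half is naturality of one unit
  followed by one triangular identity.
\<close>

lemma transpose_left:
  assumes a: "a \<in> Ob A" and f: "f \<in> hom X x (fobj T a)"
  shows "Comp X (farr T (Comp A (farr S f) (\<epsilon> a))) (\<eta> x) = f"
proof -
  have x: "x \<in> Ob X" using cX.hom_ob[OF f] by simp
  have e: "farr T (\<epsilon> a) \<in> hom X (fobj T (fobj S (fobj T a))) (fobj T a)"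
    by (rule T_hom[OF \<epsilon>_hom[OF a]])
  have "Comp X (farr T (Comp A (farr S f) (\<epsilon> a))) (\<eta> x)
      = Comp X (Comp X (farr T (\<epsilon> a)) (farr T (farr S f))) (\<eta> x)"
    by (simp add: T_comp[OF \<epsilon>_hom[OF a] S_hom[OF f]])
  also have "\<dots> = Comp X (farr T (\<epsilon> a)) (Comp X (\<eta> (fobj T a)) f)"
    using cX.comp_assoc[OF \<eta>_hom[OF x] T_hom[OF S_hom[OF f]] e] \<eta>_natural[OF f] by simp
  also have "\<dots> = Comp X (Comp X (farr T (\<epsilon> a)) (\<eta> (fobj T a))) f"
    by (rule cX.comp_assoc[OF f \<eta>_hom[OF T_ob[OF a]] e])
  also have "\<dots> = f"
    by (simp add: triangle_T[OF a] cX.comp_ide_left[OF f])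
  finally show ?thesis .
qed

lemma transpose_right:
  assumes x: "x \<in> Ob X" and \<phi>: "\<phi> \<in> hom A a (fobj S x)"
  shows "Comp A (farr S (Comp X (farr T \<phi>) (\<eta> x))) (\<epsilon> a) = \<phi>"
proof -
  have a: "a \<in> Ob A" using cA.hom_ob[OF \<phi>] by simp
  have h: "farr S (\<eta> x) \<in> hom A (fobj S (fobj T (fobj S x))) (fobj S x)"
    by (rule S_hom[OF \<eta>_hom[OF x]])
  have "Comp A (farr S (Comp X (farr T \<phi>) (\<eta> x))) (\<epsilon> a)
      = Comp A (Comp A (farr S (\<eta> x)) (farr S (farr T \<phi>))) (\<epsilon> a)"
    by (simp add: S_comp[OF \<eta>_hom[OF x] T_hom[OF \<phi>]])
  also have "\<dots> = Comp A (farr S (\<eta> x)) (Comp A (\<epsilon> (fobj S x)) \<phi>)"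
    using cA.comp_assoc[OF \<epsilon>_hom[OF a] S_hom[OF T_hom[OF \<phi>]] h] \<epsilon>_natural[OF \<phi>] by simp
  also have "\<dots> = Comp A (Comp A (farr S (\<eta> x)) (\<epsilon> (fobj S x))) \<phi>"
    by (rule cA.comp_assoc[OF \<phi> \<epsilon>_hom[OF S_ob[OF x]] h])
  also have "\<dots> = \<phi>"
    by (simp add: triangle_S[OF x] cA.comp_ide_left[OF \<phi>])
  finally show ?thesis .
qed

text \<open>
  By naturality of \<open>\<epsilon>\<close>, \<open>ST\<phi>\<close> determines \<open>\<epsilon>\<^sub>b \<circ> \<phi>\<close>, and \<open>\<epsilon>\<^sub>b\<close> has a left inverse.
\<close>

lemma T_faithful:
  assumes \<phi>: "\<phi> \<in> hom A a b" and \<psi>: "\<psi> \<in> hom A a b" and eq: "farr T \<phi> = farr T \<psi>"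
  shows "\<phi> = \<psi>"
proof -
  have b: "b \<in> Ob A" using cA.hom_ob[OF \<phi>] by simp
  obtain e where e: "e \<in> hom A (fobj S (fobj T b)) b" "Comp A e (\<epsilon> b) = Ide A b"
    using is_isoE[OF \<epsilon>_iso[OF b] \<epsilon>_hom[OF b]] by blast
  have "\<chi> = Comp A e (Comp A (farr S (farr T \<chi>)) (\<epsilon> a))" if "\<chi> \<in> hom A a b" for \<chi>
    using cA.comp_assoc[OF that \<epsilon>_hom[OF b] e(1)] e(2)
    by (simp add: \<epsilon>_natural[OF that] cA.comp_ide_left[OF that])
  then show ?thesis using \<phi> \<psi> eq by metis
qed

text \<open>
  The preimage of \<open>g\<close> is its transpose \<open>a \<rightarrow> STb\<close>, followed by the inverse of \<open>\<epsilon>\<^sub>b\<close>.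
\<close>

lemma T_full:
  assumes a: "a \<in> Ob A" and b: "b \<in> Ob A" and g: "g \<in> hom X (fobj T b) (fobj T a)"
  obtains \<phi> where "\<phi> \<in> hom A a b" "farr T \<phi> = g"
proof -
  obtain e where e: "e \<in> hom A (fobj S (fobj T b)) b" "Comp A e (\<epsilon> b) = Ide A b"
      "Comp A (\<epsilon> b) e = Ide A (fobj S (fobj T b))"
    using is_isoE[OF \<epsilon>_iso[OF b] \<epsilon>_hom[OF b]] by blast
  define \<psi> where "\<psi> = Comp A (farr S g) (\<epsilon> a)"
  define \<phi> where "\<phi> = Comp A e \<psi>"
  have \<psi>: "\<psi> \<in> hom A a (fobj S (fobj T b))"
    unfolding \<psi>_def by (rule cA.comp_hom[OF \<epsilon>_hom[OF a] S_hom[OF g]])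
  have \<phi>: "\<phi> \<in> hom A a b"
    unfolding \<phi>_def by (rule cA.comp_hom[OF \<psi> e(1)])
  have \<psi>\<phi>: "\<psi> = Comp A (\<epsilon> b) \<phi>"
    using cA.comp_assoc[OF \<psi> e(1) \<epsilon>_hom[OF b]] e(3) cA.comp_ide_left[OF \<psi>]
    by (simp add: \<phi>_def)
  have "g = Comp X (farr T \<psi>) (\<eta> (fobj T b))"
    unfolding \<psi>_def by (simp add: transpose_left[OF a g])
  also have "\<dots> = Comp X (Comp X (farr T \<phi>) (farr T (\<epsilon> b))) (\<eta> (fobj T b))"
    by (simp add: \<psi>\<phi> T_comp[OF \<phi> \<epsilon>_hom[OF b]])
  also have "\<dots> = Comp X (farr T \<phi>) (Comp X (farr T (\<epsilon> b)) (\<eta> (fobj T b)))"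
    by (rule cX.comp_assoc[OF \<eta>_hom[OF T_ob[OF b]] T_hom[OF \<epsilon>_hom[OF b]] T_hom[OF \<phi>], symmetric])
  also have "\<dots> = farr T \<phi>"
    by (simp add: triangle_T[OF b] cX.comp_ide_right[OF T_hom[OF \<phi>]])
  finally show ?thesis using that[OF \<phi>] by simp
qed

end

section \<open>Coreflections and the category \<open>B\<close>\<close>

text \<open>
  The coreflection comes with a chosen unit \<open>u\<close>, as \<open>u\<close> provides the factorization of arrows
  through \<open>\<pi>\<close>. Most computations take place in \<open>Y\<close>, where the arrows of
  \<open>X\<close> and their composites are embedded by \<open>sub_hom\<close> and \<open>sub_comp\<close>.
\<close>

locale coreflective_dual_equiv = dual_equiv A X T S \<eta> \<epsilon> + cY: category Y
  for A :: "('a, 'k) cat" and X Y :: "('y, 'n) cat"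
    and T :: "('a, 'k, 'y, 'n) ftor" and S :: "('y, 'n, 'a, 'k) ftor"
    and \<eta> :: "'y \<Rightarrow> 'n" and \<epsilon> :: "'a \<Rightarrow> 'k" +
  fixes E :: "('y, 'n, 'y, 'n) ftor" and u \<pi> :: "'y \<Rightarrow> 'n"
  assumes full_subcategory: "full_subcategory X Y"
    and coreflection: "adjunction X Y inclusion_functor E u \<pi>"
begin

abbreviation comp_Y (infixr "\<odot>" 70) where "g \<odot> f \<equiv> Comp Y g f"
abbreviation "P \<equiv> P_class X Y E \<pi>"
abbreviation "B \<equiv> cat_C A Y T P"
abbreviation "I \<equiv> embedding_C A Y T"

lemma sub_ob: "x \<in> Ob X \<Longrightarrow> x \<in> Ob Y"
  and sub_ide: "x \<in> Ob X \<Longrightarrow> Ide X x = Ide Y x"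
  and sub_hom: "f \<in> hom X x y \<Longrightarrow> f \<in> hom Y x y"
  and sub_comp: "f \<in> hom X x y \<Longrightarrow> g \<in> hom X y z \<Longrightarrow> Comp X g f = g \<odot> f"
  using full_subcategory by (auto simp: full_subcategory_def hom_def)

lemma hom_full: "x \<in> Ob X \<Longrightarrow> y \<in> Ob X \<Longrightarrow> f \<in> hom Y x y \<Longrightarrow> f \<in> hom X x y"
  using full_subcategory by (auto simp: full_subcategory_def hom_def)

lemma E_functor: "is_functor Y X E"
  and J_functor: "is_functor X Y inclusion_functor"
  using coreflection by (auto simp: adjunction_def)

lemma E_ob: "y \<in> Ob Y \<Longrightarrow> fobj E y \<in> Ob X"
  and E_hom: "f \<in> hom Y y z \<Longrightarrow> farr E f \<in> hom X (fobj E y) (fobj E z)"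
  and E_ide: "y \<in> Ob Y \<Longrightarrow> farr E (Ide Y y) = Ide X (fobj E y)"
  using is_functorD(3-5)[OF E_functor] by auto

lemma \<pi>_hom: "y \<in> Ob Y \<Longrightarrow> \<pi> y \<in> hom Y (fobj E y) y"
  and \<pi>_natural: "f \<in> hom Y y z \<Longrightarrow> \<pi> z \<odot> farr E f = f \<odot> \<pi> y"
  and u_hom: "x \<in> Ob X \<Longrightarrow> u x \<in> hom X x (fobj E x)"
  and u_natural: "f \<in> hom X x x' \<Longrightarrow> Comp X (farr E f) (u x) = Comp X (u x') f"
proof -
  have "nat_trans Y Y (inclusion_functor \<cdot> E) id_functor \<pi>"
      "nat_trans X X id_functor (E \<cdot> inclusion_functor) u"
    using coreflection by (auto simp: adjunction_def)
  note n = nat_transD[OF this(1)] nat_transD[OF this(2)]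
  show "y \<in> Ob Y \<Longrightarrow> \<pi> y \<in> hom Y (fobj E y) y"
    and "f \<in> hom Y y z \<Longrightarrow> \<pi> z \<odot> farr E f = f \<odot> \<pi> y"
    and "x \<in> Ob X \<Longrightarrow> u x \<in> hom X x (fobj E x)"
    and "f \<in> hom X x x' \<Longrightarrow> Comp X (farr E f) (u x) = Comp X (u x') f"
    using n by auto
qed

lemma \<pi>_u: "x \<in> Ob X \<Longrightarrow> \<pi> x \<odot> u x = Ide Y x"
  and E\<pi>_u: "y \<in> Ob Y \<Longrightarrow> Comp X (farr E (\<pi> y)) (u (fobj E y)) = Ide X (fobj E y)"
  using coreflection by (auto simp: adjunction_def)

text \<open>
  An arrow \<open>k\<close> of \<open>X\<close> into \<open>Ey\<close> is the transpose \<open>E(\<pi>\<^sub>y \<circ> k) \<circ> u\<close> of its composite with \<open>\<pi>\<^sub>y\<close>.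
\<close>

lemma \<pi>_cancel:
  assumes y: "y \<in> Ob Y" and x: "x \<in> Ob X"
    and g: "g \<in> hom Y x (fobj E y)" and h: "h \<in> hom Y x (fobj E y)"
    and eq: "\<pi> y \<odot> g = \<pi> y \<odot> h"
  shows "g = h"
proof -
  have "k = Comp X (farr E (\<pi> y \<odot> k)) (u x)" if k: "k \<in> hom Y x (fobj E y)" for k
  proof -
    have k': "k \<in> hom X x (fobj E y)" by (rule hom_full[OF x E_ob[OF y] k])
    note E\<pi> = E_hom[OF \<pi>_hom[OF y]] and uE = u_hom[OF E_ob[OF y]]
    have "k = Comp X (Comp X (farr E (\<pi> y)) (u (fobj E y))) k"
      by (simp add: E\<pi>_u[OF y] cX.comp_ide_left[OF k'])
    also have "\<dots> = Comp X (farr E (\<pi> y)) (Comp X (farr E k) (u x))"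
      using cX.comp_assoc[OF k' uE E\<pi>] u_natural[OF k'] by simp
    also have "\<dots> = Comp X (Comp X (farr E (\<pi> y)) (farr E k)) (u x)"
      by (rule cX.comp_assoc[OF u_hom[OF x] E_hom[OF k] E\<pi>])
    also have "\<dots> = Comp X (farr E (\<pi> y \<odot> k)) (u x)"
      by (simp add: is_functorD(6)[OF E_functor k \<pi>_hom[OF y]])
    finally show ?thesis .
  qed
  then show ?thesis using g h eq by metis
qed

text \<open>
  Fullness of \<open>X\<close> is what puts \<open>\<pi>\<^sub>x\<close>, the candidate inverse, into \<open>X\<close>. The isomorphism \<open>u\<^sub>x\<close>
  exhibits \<open>1\<^sub>x = \<pi>\<^sub>x \<circ> u\<^sub>x\<close> as a member of \<open>P\<^sub>\<pi>\<close>, so that the objects \<open>(a, 1)\<close> lie in \<open>B\<close>.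
\<close>

lemma u_iso:
  assumes x: "x \<in> Ob X"
  shows "is_iso X (u x)"
proof -
  note xY = sub_ob[OF x] and Ex = E_ob[OF sub_ob[OF x]] and u = u_hom[OF x]
  have \<pi>: "\<pi> x \<in> hom X (fobj E x) x" by (rule hom_full[OF Ex x \<pi>_hom[OF xY]])
  have "\<pi> x \<odot> (u x \<odot> \<pi> x) = (\<pi> x \<odot> u x) \<odot> \<pi> x"
    by (rule cY.comp_assoc[OF sub_hom[OF \<pi>] sub_hom[OF u] sub_hom[OF \<pi>]])
  also have "\<dots> = \<pi> x \<odot> Ide Y (fobj E x)"
    by (simp add: \<pi>_u[OF x] cY.comp_ide_left[OF sub_hom[OF \<pi>]] cY.comp_ide_right[OF sub_hom[OF \<pi>]])
  finally have "u x \<odot> \<pi> x = Ide Y (fobj E x)"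
    by (rule \<pi>_cancel[OF xY Ex cY.comp_hom[OF sub_hom[OF \<pi>] sub_hom[OF u]]
          cY.ide_hom[OF sub_ob[OF Ex]]])
  then show ?thesis
    using is_isoI[OF u \<pi>] \<pi>_u[OF x]
    by (simp add: sub_comp[OF u \<pi>] sub_comp[OF \<pi> u] sub_ide[OF x] sub_ide[OF Ex])
qed

lemma P_I:
  assumes "y \<in> Ob Y" "is_iso X \<alpha>" "Cod X \<alpha> = fobj E y"
  shows "\<pi> y \<odot> \<alpha> \<in> P"
  using assms by (auto simp: P_class_def)

lemma P_E:
  assumes "p \<in> P"
  obtains y \<alpha> \<alpha>' where "y \<in> Ob Y" "p \<in> hom Y (Dom Y p) y" "Dom Y p \<in> Ob X"
    "\<alpha> \<in> hom X (Dom Y p) (fobj E y)" "\<alpha>' \<in> hom X (fobj E y) (Dom Y p)"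
    "p = \<pi> y \<odot> \<alpha>" "\<alpha>' \<odot> \<alpha> = Ide Y (Dom Y p)" "p \<odot> \<alpha>' = \<pi> y"
proof -
  from assms obtain y \<alpha> where y: "y \<in> Ob Y" and \<alpha>: "is_iso X \<alpha>" "Cod X \<alpha> = fobj E y"
    and p: "p = \<pi> y \<odot> \<alpha>" by (auto simp: P_class_def)
  define x where "x = Dom X \<alpha>"
  have \<alpha>h: "\<alpha> \<in> hom X x (fobj E y)" using \<alpha> by (auto simp: is_iso_def hom_def x_def)
  obtain \<alpha>' where \<alpha>': "\<alpha>' \<in> hom X (fobj E y) x" "Comp X \<alpha>' \<alpha> = Ide X x"
      "Comp X \<alpha> \<alpha>' = Ide X (fobj E y)"
    using is_isoE[OF \<alpha>(1) \<alpha>h] by blast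
  have x: "x \<in> Ob X" using cX.hom_ob[OF \<alpha>h] by simp
  have ph: "p \<in> hom Y x y" unfolding p by (rule cY.comp_hom[OF sub_hom[OF \<alpha>h] \<pi>_hom[OF y]])
  have d: "Dom Y p = x" using ph by (simp add: hom_def)
  have "p \<odot> \<alpha>' = \<pi> y \<odot> (\<alpha> \<odot> \<alpha>')"
    unfolding p using cY.comp_assoc[OF sub_hom[OF \<alpha>'(1)] sub_hom[OF \<alpha>h] \<pi>_hom[OF y]] by simp
  also have "\<dots> = \<pi> y"
    using \<alpha>'(3) by (simp add: sub_comp[OF \<alpha>'(1) \<alpha>h] sub_ide[OF E_ob[OF y]]
        cY.comp_ide_right[OF \<pi>_hom[OF y]])
  finally have "p \<odot> \<alpha>' = \<pi> y" .
  moreover have "\<alpha>' \<odot> \<alpha> = Ide Y x"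
    using \<alpha>'(2) by (simp add: sub_comp[OF \<alpha>h \<alpha>'(1)] sub_ide[OF x])
  ultimately show ?thesis using that[unfolded d, OF y ph x \<alpha>h \<alpha>'(1) p] by blast
qed

text \<open>
  Together with \<open>P_factor\<close> this says that a morphism of \<open>P\<^sub>\<pi>\<close> has the universal property of the
  coreflection \<open>\<pi>\<close>, inherited along the isomorphism \<open>\<alpha>\<close> of its domain with \<open>Ey\<close>.
\<close>

lemma P_cancel:
  assumes p: "p \<in> P" and x: "x \<in> Ob X"
    and g: "g \<in> hom X x (Dom Y p)" and h: "h \<in> hom X x (Dom Y p)" and eq: "p \<odot> g = p \<odot> h"
  shows "g = h"
proof -
  from p obtain y \<alpha> \<alpha>' where y: "y \<in> Ob Y" and \<alpha>: "\<alpha> \<in> hom X (Dom Y p) (fobj E y)"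
    and \<alpha>': "\<alpha>' \<in> hom X (fobj E y) (Dom Y p)" and p\<alpha>: "p = \<pi> y \<odot> \<alpha>"
    and inv: "\<alpha>' \<odot> \<alpha> = Ide Y (Dom Y p)" by (rule P_E)
  note gY = sub_hom[OF g] and hY = sub_hom[OF h] and \<alpha>Y = sub_hom[OF \<alpha>] and \<alpha>'Y = sub_hom[OF \<alpha>']
  have "\<pi> y \<odot> (\<alpha> \<odot> g) = p \<odot> g" "\<pi> y \<odot> (\<alpha> \<odot> h) = p \<odot> h"
    using cY.comp_assoc[OF gY \<alpha>Y \<pi>_hom[OF y]] cY.comp_assoc[OF hY \<alpha>Y \<pi>_hom[OF y]] p\<alpha> by auto
  then have "\<alpha> \<odot> g = \<alpha> \<odot> h"
    using \<pi>_cancel[OF y x cY.comp_hom[OF gY \<alpha>Y] cY.comp_hom[OF hY \<alpha>Y]] eq by simp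
  then have "(\<alpha>' \<odot> \<alpha>) \<odot> g = (\<alpha>' \<odot> \<alpha>) \<odot> h"
    using cY.comp_assoc[OF gY \<alpha>Y \<alpha>'Y] cY.comp_assoc[OF hY \<alpha>Y \<alpha>'Y] by simp
  then show ?thesis by (simp add: inv cY.comp_ide_left[OF gY] cY.comp_ide_left[OF hY])
qed

lemma P_factor:
  assumes p: "p \<in> P" and x: "x \<in> Ob X" and g: "g \<in> hom Y x (Cod Y p)"
  obtains h where "h \<in> hom X x (Dom Y p)" "p \<odot> h = g"
proof -
  from p obtain y \<alpha> \<alpha>' where y: "y \<in> Ob Y" and ph: "p \<in> hom Y (Dom Y p) y"
    and \<alpha>': "\<alpha>' \<in> hom X (fobj E y) (Dom Y p)" and p\<alpha>': "p \<odot> \<alpha>' = \<pi> y" by (rule P_E)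
  have g: "g \<in> hom Y x y" using g ph by (simp add: hom_def)
  note u = u_hom[OF x] and Eg = E_hom[OF g]
  define k where "k = Comp X (farr E g) (u x)"
  have k: "k \<in> hom X x (fobj E y)" unfolding k_def by (rule cX.comp_hom[OF u Eg])
  have "\<pi> y \<odot> k = \<pi> y \<odot> (farr E g \<odot> u x)" by (simp add: k_def sub_comp[OF u Eg])
  also have "\<dots> = (g \<odot> \<pi> x) \<odot> u x"
    using cY.comp_assoc[OF sub_hom[OF u] sub_hom[OF Eg] \<pi>_hom[OF y]] \<pi>_natural[OF g] by simp
  also have "\<dots> = g \<odot> (\<pi> x \<odot> u x)"
    using cY.comp_assoc[OF sub_hom[OF u] \<pi>_hom[OF sub_ob[OF x]] g] by simp
  also have "\<dots> = g" by (simp add: \<pi>_u[OF x] cY.comp_ide_right[OF g])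
  finally have "p \<odot> (\<alpha>' \<odot> k) = g"
    using cY.comp_assoc[OF sub_hom[OF k] sub_hom[OF \<alpha>'] ph] p\<alpha>' by simp
  then show ?thesis
    using that[OF cX.comp_hom[OF k \<alpha>']] by (simp add: sub_comp[OF k \<alpha>'])
qed

lemma Ob_B_iff: "(a, p) \<in> Ob B \<longleftrightarrow> a \<in> Ob A \<and> p \<in> P \<and> Dom Y p = fobj T a"
  by (simp add: cat_C_def cat_C_obj_def)

lemma Ob_B_hom:
  assumes "(a, p) \<in> Ob B"
  shows "p \<in> hom Y (fobj T a) (Cod Y p)" "Cod Y p \<in> Ob Y"
proof -
  obtain y where "y \<in> Ob Y" "p \<in> hom Y (Dom Y p) y" using assms P_E by (metis Ob_B_iff)
  then show "p \<in> hom Y (fobj T a) (Cod Y p)" "Cod Y p \<in> Ob Y"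
    using assms by (auto simp: Ob_B_iff hom_def)
qed

lemma hom_B_iff:
  "F \<in> hom B (a, p) (a', p') \<longleftrightarrow> (\<exists>\<phi> f. F = ((a, p), (\<phi>, f), (a', p')) \<and>
     (a, p) \<in> Ob B \<and> (a', p') \<in> Ob B \<and> \<phi> \<in> hom A a a' \<and> f \<in> hom Y (Cod Y p') (Cod Y p) \<and>
     p \<odot> farr T \<phi> = f \<odot> p')"
  by (auto simp: cat_C_def hom_def)

lemma hom_B_E:
  assumes "F \<in> hom B (a, p) (a', p')"
  obtains \<phi> f where "F = ((a, p), (\<phi>, f), (a', p'))" "(a, p) \<in> Ob B" "(a', p') \<in> Ob B"
    "\<phi> \<in> hom A a a'" "f \<in> hom Y (Cod Y p') (Cod Y p)" "p \<odot> farr T \<phi> = f \<odot> p'"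
  using assms by (auto simp: hom_B_iff)

lemma Comp_B [simp]:
  "Comp B (d, (\<phi>', f'), b'') (b, (\<phi>, f), d') = (b, (Comp A \<phi>' \<phi>, f \<odot> f'), b'')"
  by (simp add: cat_C_def)

lemma Ide_B [simp]: "Ide B (a, p) = ((a, p), (Ide A a, Ide Y (Cod Y p)), (a, p))"
  by (simp add: cat_C_def)

lemma category_B: "category B"
proof
  fix F :: "('a, 'k, 'n) c_arr" assume "F \<in> Arr B"
  then show "Dom B F \<in> Ob B" "Cod B F \<in> Ob B" by (auto simp: cat_C_def)
next
  fix b assume b: "b \<in> Ob B"
  obtain a p where ap: "b = (a, p)" by force
  have a: "a \<in> Ob A" using b by (simp add: ap Ob_B_iff)
  note p = Ob_B_hom[OF b[unfolded ap]]
  have "p \<odot> farr T (Ide A a) = Ide Y (Cod Y p) \<odot> p"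
    by (simp add: T_ide[OF a] sub_ide[OF T_ob[OF a]] cY.comp_ide_left[OF p(1)]
        cY.comp_ide_right[OF p(1)])
  then show "Ide B b \<in> hom B b b"
    using b cA.ide_hom[OF a] cY.ide_hom[OF p(2)] by (simp add: ap hom_B_iff)
next
  fix F G and b c d assume F: "F \<in> hom B b c" and G: "G \<in> hom B c d"
  obtain a p a' p' a'' p'' where eqs: "b = (a, p)" "c = (a', p')" "d = (a'', p'')"
    by (metis surj_pair)
  obtain \<phi> f where f: "F = ((a, p), (\<phi>, f), (a', p'))" "(a, p) \<in> Ob B" "(a', p') \<in> Ob B"
      "\<phi> \<in> hom A a a'" "f \<in> hom Y (Cod Y p') (Cod Y p)" "p \<odot> farr T \<phi> = f \<odot> p'"
    using F unfolding eqs by (rule hom_B_E)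
  obtain \<psi> g where g: "G = ((a', p'), (\<psi>, g), (a'', p''))" "(a'', p'') \<in> Ob B"
      "\<psi> \<in> hom A a' a''" "g \<in> hom Y (Cod Y p'') (Cod Y p')" "p' \<odot> farr T \<psi> = g \<odot> p''"
    using G unfolding eqs by (rule hom_B_E)
  note h = Ob_B_hom(1)[OF f(2)] Ob_B_hom(1)[OF f(3)] Ob_B_hom(1)[OF g(2)]
  note T\<phi> = T_hom[OF f(4)] and T\<psi> = T_hom[OF g(3)]
  have "p \<odot> farr T (Comp A \<psi> \<phi>) = (p \<odot> farr T \<phi>) \<odot> farr T \<psi>"
    using cY.comp_assoc[OF sub_hom[OF T\<psi>] sub_hom[OF T\<phi>] h(1)]
    by (simp add: T_comp[OF f(4) g(3)] sub_comp[OF T\<psi> T\<phi>])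
  also have "\<dots> = f \<odot> (g \<odot> p'')"
    using cY.comp_assoc[OF sub_hom[OF T\<psi>] h(2) f(5)] by (simp add: f(6) g(5))
  also have "\<dots> = (f \<odot> g) \<odot> p''"
    by (rule cY.comp_assoc[OF h(3) g(4) f(5)])
  finally show "Comp B G F \<in> hom B b d"
    using f(2) g(2) cA.comp_hom[OF f(4) g(3)] cY.comp_hom[OF g(4) f(5)]
    by (simp add: eqs f(1) g(1) hom_B_iff)
next
  fix F b c assume F: "F \<in> hom B b c"
  obtain a p a' p' where eqs: "b = (a, p)" "c = (a', p')" by (metis surj_pair)
  obtain \<phi> f where f: "F = ((a, p), (\<phi>, f), (a', p'))"
      "\<phi> \<in> hom A a a'" "f \<in> hom Y (Cod Y p') (Cod Y p)"
    using F unfolding eqs by (rule hom_B_E)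
  show "Comp B F (Ide B b) = F" "Comp B (Ide B c) F = F"
    by (simp_all add: eqs f(1) cA.comp_ide_right[OF f(2)] cA.comp_ide_left[OF f(2)]
        cY.comp_ide_left[OF f(3)] cY.comp_ide_right[OF f(3)])
next
  fix F G H b c d e assume F: "F \<in> hom B b c" and G: "G \<in> hom B c d" and H: "H \<in> hom B d e"
  obtain a p a' p' a'' p'' a3 p3 where eqs: "b = (a, p)" "c = (a', p')" "d = (a'', p'')"
    "e = (a3, p3)" by (metis surj_pair)
  obtain \<phi> f where f: "F = ((a, p), (\<phi>, f), (a', p'))"
      "\<phi> \<in> hom A a a'" "f \<in> hom Y (Cod Y p') (Cod Y p)"
    using F unfolding eqs by (rule hom_B_E)
  obtain \<psi> g where g: "G = ((a', p'), (\<psi>, g), (a'', p''))"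
      "\<psi> \<in> hom A a' a''" "g \<in> hom Y (Cod Y p'') (Cod Y p')"
    using G unfolding eqs by (rule hom_B_E)
  obtain \<chi> h where h: "H = ((a'', p''), (\<chi>, h), (a3, p3))"
      "\<chi> \<in> hom A a'' a3" "h \<in> hom Y (Cod Y p3) (Cod Y p'')"
    using H unfolding eqs by (rule hom_B_E)
  show "Comp B H (Comp B G F) = Comp B (Comp B H G) F"
    by (simp add: f(1) g(1) h(1) cA.comp_assoc[OF f(2) g(2) h(2)]
        cY.comp_assoc[OF h(3) g(3) f(3)])
qed

sublocale cB: category B
  by (rule category_B)

section \<open>The lifted dual equivalence\<close>

definition T' :: "('a \<times> 'n, ('a, 'k, 'n) c_arr, 'y, 'n) ftor" where
  "T' = \<lparr>fobj = (\<lambda>(a, p). Cod Y p), farr = (\<lambda>(b, (\<phi>, f), b'). f)\<rparr>"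

lemma T'_simps [simp]: "fobj T' (a, p) = Cod Y p" "farr T' (b, (\<phi>, f), b') = f"
  by (simp_all add: T'_def)

lemma T'_functor: "is_functor (op B) Y T'"
proof (rule is_functorI)
  show "category (op B)" "category Y" by (simp_all add: category_B cY.category_axioms)
  show "fobj T' b \<in> Ob Y" if "b \<in> Ob (op B)" for b
    using that Ob_B_hom(2) by (cases b) auto
  show "farr T' F \<in> hom Y (fobj T' c) (fobj T' b)" if "F \<in> hom (op B) c b" for F b c
    using that by (cases b; cases c) (auto simp: hom_B_iff)
  show "farr T' (Ide (op B) b) = Ide Y (fobj T' b)" for b
    by (cases b) simp
  show "farr T' (Comp (op B) G F) = farr T' G \<odot> farr T' F"
    if "F \<in> hom (op B) b c" "G \<in> hom (op B) c d" for F G b c d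
    using that by (cases b; cases c; cases d) (auto simp: hom_B_iff)
qed

lemma T'_ob: "b \<in> Ob B \<Longrightarrow> fobj T' b \<in> Ob Y"
  and T'_hom: "F \<in> hom B b c \<Longrightarrow> farr T' F \<in> hom Y (fobj T' c) (fobj T' b)"
  and T'_ide: "b \<in> Ob B \<Longrightarrow> farr T' (Ide B b) = Ide Y (fobj T' b)"
  and T'_comp: "F \<in> hom B b c \<Longrightarrow> G \<in> hom B c d \<Longrightarrow>
    farr T' (Comp B G F) = farr T' F \<odot> farr T' G"
  using is_functorD(3-6)[OF T'_functor] by auto

text \<open>
  The component \<open>\<phi>\<close> is recovered from \<open>f\<close>: \<open>p \<circ> T\<phi> = f \<circ> p'\<close> determines \<open>T\<phi>\<close> by the universal
  property of \<open>p\<close>, and \<open>T\<close> is faithful.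
\<close>

lemma T'_faithful:
  assumes F: "F \<in> hom B b c" and G: "G \<in> hom B b c" and eq: "farr T' F = farr T' G"
  shows "F = G"
proof -
  obtain a p a' p' where eqs: "b = (a, p)" "c = (a', p')" by (metis surj_pair)
  obtain \<phi> f where f: "F = ((a, p), (\<phi>, f), (a', p'))" "(a, p) \<in> Ob B" "(a', p') \<in> Ob B"
      "\<phi> \<in> hom A a a'" "p \<odot> farr T \<phi> = f \<odot> p'"
    using F unfolding eqs by (rule hom_B_E)
  obtain \<psi> g where g: "G = ((a, p), (\<psi>, g), (a', p'))"
      "\<psi> \<in> hom A a a'" "p \<odot> farr T \<psi> = g \<odot> p'"
    using G unfolding eqs by (rule hom_B_E)
  have fg: "f = g" using eq f(1) g(1) by simp
  have p: "p \<in> P" "Dom Y p = fobj T a" and a': "a' \<in> Ob A" using f(2,3) by (auto simp: Ob_B_iff)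
  have "farr T \<phi> = farr T \<psi>"
    using P_cancel[OF p(1) T_ob[OF a']] T_hom[OF f(4)] T_hom[OF g(2)] f(5) g(3) p(2) fg by simp
  then show ?thesis using T_faithful[OF f(4) g(2)] f(1) g(1) fg by simp
qed

text \<open>
  The arrow \<open>f \<circ> p'\<close> has its domain \<open>Ta'\<close> in \<open>X\<close>, so it factors through \<open>p\<close> by an arrow of \<open>X\<close>,
  and fullness of \<open>T\<close> turns the factor into the missing component \<open>\<phi>\<close>.
\<close>

lemma T'_full:
  assumes b: "b \<in> Ob B" and c: "c \<in> Ob B" and f: "f \<in> hom Y (fobj T' c) (fobj T' b)"
  obtains F where "F \<in> hom B b c" "farr T' F = f"
proof -
  obtain a p a' p' where eqs: "b = (a, p)" "c = (a', p')" by (metis surj_pair)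
  have p: "p \<in> P" "Dom Y p = fobj T a" and a: "a \<in> Ob A" and a': "a' \<in> Ob A"
    using b c by (auto simp: eqs Ob_B_iff)
  have f': "f \<in> hom Y (Cod Y p') (Cod Y p)" using f by (simp add: eqs)
  have "f \<odot> p' \<in> hom Y (fobj T a') (Cod Y p)"
    by (rule cY.comp_hom[OF Ob_B_hom(1)[OF c[unfolded eqs]] f'])
  then obtain h where h: "h \<in> hom X (fobj T a') (fobj T a)" "p \<odot> h = f \<odot> p'"
    using P_factor[OF p(1) T_ob[OF a']] p(2) by metis
  obtain \<phi> where \<phi>: "\<phi> \<in> hom A a a'" "farr T \<phi> = h" using T_full[OF a a' h(1)] by blast
  show ?thesis
    using that[of "((a, p), (\<phi>, f), (a', p'))"] b c \<phi> h(2) f' by (simp add: eqs hom_B_iff)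
qed

lemma T'_reflects_iso:
  assumes F: "F \<in> hom B b c" and iso: "is_iso Y (farr T' F)"
  shows "is_iso B F"
proof -
  note bc = cB.hom_ob[OF F]
  obtain g where g: "g \<in> hom Y (fobj T' b) (fobj T' c)" "g \<odot> farr T' F = Ide Y (fobj T' c)"
      "farr T' F \<odot> g = Ide Y (fobj T' b)"
    using is_isoE[OF iso T'_hom[OF F]] by blast
  obtain G where G: "G \<in> hom B c b" "farr T' G = g" using T'_full[OF bc(2,1) g(1)] by blast
  have "Comp B G F = Ide B b"
    using g(3) by (intro T'_faithful[OF cB.comp_hom[OF F G(1)] cB.ide_hom[OF bc(1)]])
      (simp add: T'_comp[OF F G(1)] G(2) T'_ide[OF bc(1)])
  moreover have "Comp B F G = Ide B c"
    using g(2) by (intro T'_faithful[OF cB.comp_hom[OF G(1) F] cB.ide_hom[OF bc(2)]])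
      (simp add: T'_comp[OF G(1) F] G(2) T'_ide[OF bc(2)])
  ultimately show ?thesis by (rule is_isoI[OF F G(1)])
qed

text \<open>
  The arrow \<open>\<pi>\<^sub>y \<circ> \<eta>\<^bsub>Ey\<^esub>\<^sup>-\<^sup>1 : TSEy \<rightarrow> y\<close>, described without inverting \<open>\<eta>\<close>.
\<close>

definition proj :: "'y \<Rightarrow> 'n" where
  "proj y = (SOME p. (fobj S (fobj E y), p) \<in> Ob B \<and> Cod Y p = y \<and> p \<odot> \<eta> (fobj E y) = \<pi> y)"

lemma proj:
  assumes y: "y \<in> Ob Y"
  shows "(fobj S (fobj E y), proj y) \<in> Ob B" "Cod Y (proj y) = y"
    "proj y \<odot> \<eta> (fobj E y) = \<pi> y"
proof -
  note Ey = E_ob[OF y]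
  note h = \<eta>_hom[OF Ey] and \<pi> = \<pi>_hom[OF y]
  obtain \<alpha> where \<alpha>: "\<alpha> \<in> hom X (fobj T (fobj S (fobj E y))) (fobj E y)"
      "Comp X \<alpha> (\<eta> (fobj E y)) = Ide X (fobj E y)"
      "Comp X (\<eta> (fobj E y)) \<alpha> = Ide X (fobj T (fobj S (fobj E y)))"
    using is_isoE[OF \<eta>_iso[OF Ey] \<eta>_hom[OF Ey]] by blast
  have p: "\<pi> y \<odot> \<alpha> \<in> hom Y (fobj T (fobj S (fobj E y))) y"
    by (rule cY.comp_hom[OF sub_hom[OF \<alpha>(1)] \<pi>])
  have "\<pi> y \<odot> \<alpha> \<in> P"
    by (rule P_I[OF y is_isoI[OF \<alpha>(1) h \<alpha>(3,2)] homD(3)[OF \<alpha>(1)]])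
  then have "(fobj S (fobj E y), \<pi> y \<odot> \<alpha>) \<in> Ob B"
    using S_ob[OF Ey] homD(2)[OF p] by (simp add: Ob_B_iff)
  moreover have "(\<pi> y \<odot> \<alpha>) \<odot> \<eta> (fobj E y) = \<pi> y"
    using cY.comp_assoc[OF sub_hom[OF h] sub_hom[OF \<alpha>(1)] \<pi>] \<alpha>(2)
    by (simp add: sub_comp[OF h \<alpha>(1)] sub_ide[OF Ey] cY.comp_ide_right[OF \<pi>])
  ultimately have "\<exists>p. (fobj S (fobj E y), p) \<in> Ob B \<and> Cod Y p = y \<and> p \<odot> \<eta> (fobj E y) = \<pi> y"
    using homD(3)[OF p] by blast
  from someI_ex[OF this] show "(fobj S (fobj E y), proj y) \<in> Ob B" "Cod Y (proj y) = y"
    "proj y \<odot> \<eta> (fobj E y) = \<pi> y" by (auto simp: proj_def)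
qed

definition S' :: "('y, 'n, 'a \<times> 'n, ('a, 'k, 'n) c_arr) ftor" where
  "S' = \<lparr>fobj = (\<lambda>y. (fobj S (fobj E y), proj y)),
         farr = (\<lambda>f. ((fobj S (fobj E (Cod Y f)), proj (Cod Y f)), (farr S (farr E f), f),
                      (fobj S (fobj E (Dom Y f)), proj (Dom Y f))))\<rparr>"

lemma S'_ob: "y \<in> Ob Y \<Longrightarrow> fobj S' y \<in> Ob B"
  and T'S'_ob: "y \<in> Ob Y \<Longrightarrow> fobj T' (fobj S' y) = y"
  and T'S'_arr: "farr T' (farr S' f) = f"
  by (simp_all add: S'_def proj)

text \<open>
  The pair \<open>(SEf, f)\<close> is an arrow of \<open>B\<close> because \<open>\<eta>\<close> and \<open>\<pi>\<close> are natural: both sides of the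
  required square agree after composition with the isomorphism \<open>\<eta>\<^bsub>Ey\<^esub>\<close>.
\<close>

lemma S'_hom:
  assumes f: "f \<in> hom Y y z"
  shows "farr S' f \<in> hom B (fobj S' z) (fobj S' y)"
proof -
  note yz = cY.hom_ob[OF f]
  note Ef = E_hom[OF f] and Ey = E_ob[OF yz(1)] and Ez = E_ob[OF yz(2)]
  note py = Ob_B_hom(1)[OF proj(1)[OF yz(1)], unfolded proj(2)[OF yz(1)]]
  note pz = Ob_B_hom(1)[OF proj(1)[OF yz(2)], unfolded proj(2)[OF yz(2)]]
  note TSEf = T_hom[OF S_hom[OF Ef]]
  note hy = \<eta>_hom[OF Ey] and hz = \<eta>_hom[OF Ez]
  obtain e where e: "e \<in> hom X (fobj T (fobj S (fobj E y))) (fobj E y)"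
      "Comp X (\<eta> (fobj E y)) e = Ide X (fobj T (fobj S (fobj E y)))"
    using is_isoE[OF \<eta>_iso[OF Ey] hy] by blast
  have he: "\<eta> (fobj E y) \<odot> e = Ide Y (fobj T (fobj S (fobj E y)))"
    using e(2) by (simp add: sub_comp[OF e(1) hy] sub_ide[OF T_ob[OF S_ob[OF Ey]]])
  have "(proj z \<odot> farr T (farr S (farr E f))) \<odot> \<eta> (fobj E y)
      = proj z \<odot> (\<eta> (fobj E z) \<odot> farr E f)"
    using cY.comp_assoc[OF sub_hom[OF hy] sub_hom[OF TSEf] pz] \<eta>_natural[OF Ef]
    by (simp add: sub_comp[OF hy TSEf] sub_comp[OF Ef hz])
  also have "\<dots> = \<pi> z \<odot> farr E f"
    using cY.comp_assoc[OF sub_hom[OF Ef] sub_hom[OF hz] pz] by (simp add: proj(3)[OF yz(2)])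
  also have "\<dots> = f \<odot> \<pi> y" by (rule \<pi>_natural[OF f])
  also have "\<dots> = (f \<odot> proj y) \<odot> \<eta> (fobj E y)"
    using cY.comp_assoc[OF sub_hom[OF hy] py f] by (simp add: proj(3)[OF yz(1)])
  finally have eq: "(proj z \<odot> farr T (farr S (farr E f))) \<odot> \<eta> (fobj E y)
      = (f \<odot> proj y) \<odot> \<eta> (fobj E y)" .
  have cancel: "k = (k \<odot> \<eta> (fobj E y)) \<odot> e" if k: "k \<in> hom Y (fobj T (fobj S (fobj E y))) z" for k
    using cY.comp_assoc[OF sub_hom[OF e(1)] sub_hom[OF hy] k]
    by (simp add: he cY.comp_ide_right[OF k])
  have "proj z \<odot> farr T (farr S (farr E f)) = f \<odot> proj y"
    using cancel[OF cY.comp_hom[OF sub_hom[OF TSEf] pz]] cancel[OF cY.comp_hom[OF py f]] eq by simp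
  then show ?thesis
    using proj(1)[OF yz(1)] proj(1)[OF yz(2)] S_hom[OF Ef] f
    by (simp add: S'_def homD[OF f] hom_B_iff proj(2)[OF yz(1)] proj(2)[OF yz(2)])
qed

lemma S'_functor: "is_functor Y (op B) S'"
proof (rule is_functorI)
  show "category Y" "category (op B)" by (simp_all add: category_B cY.category_axioms)
  show "fobj S' y \<in> Ob (op B)" if "y \<in> Ob Y" for y using S'_ob[OF that] by simp
  show S'h: "farr S' f \<in> hom (op B) (fobj S' y) (fobj S' z)" if "f \<in> hom Y y z" for f y z
    using S'_hom[OF that] by simp
  show "farr S' (Ide Y y) = Ide (op B) (fobj S' y)" if y: "y \<in> Ob Y" for y
    using T'_faithful[OF S'_hom[OF cY.ide_hom[OF y]] cB.ide_hom[OF S'_ob[OF y]]]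
    by (simp add: T'S'_arr T'_ide[OF S'_ob[OF y]] T'S'_ob[OF y])
  show "farr S' (g \<odot> f) = Comp (op B) (farr S' g) (farr S' f)"
    if f: "f \<in> hom Y x y" and g: "g \<in> hom Y y z" for f g x y z
    using T'_faithful[OF S'_hom[OF cY.comp_hom[OF f g]] cB.comp_hom[OF S'_hom[OF g] S'_hom[OF f]]]
    by (simp add: T'S'_arr T'_comp[OF S'_hom[OF g] S'_hom[OF f]])
qed

text \<open>
  The choice is unique because \<open>T'\<close> is faithful; its first component is the canonical isomorphism
  \<open>a \<rightarrow> SEy\<close>, where \<open>y\<close> is the codomain of \<open>p\<close>.
\<close>

definition \<epsilon>' :: "'a \<times> 'n \<Rightarrow> ('a, 'k, 'n) c_arr" where
  "\<epsilon>' b = (SOME F. F \<in> hom B b (fobj S' (fobj T' b)) \<and> farr T' F = Ide Y (fobj T' b))"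

lemma \<epsilon>':
  assumes b: "b \<in> Ob B"
  shows "\<epsilon>' b \<in> hom B b (fobj S' (fobj T' b))" "farr T' (\<epsilon>' b) = Ide Y (fobj T' b)"
proof -
  note y = T'_ob[OF b]
  obtain F where "F \<in> hom B b (fobj S' (fobj T' b))" "farr T' F = Ide Y (fobj T' b)"
    using T'_full[OF b S'_ob[OF y]] cY.ide_hom[OF y] T'S'_ob[OF y] by metis
  then have "\<exists>F. F \<in> hom B b (fobj S' (fobj T' b)) \<and> farr T' F = Ide Y (fobj T' b)" by blast
  from someI_ex[OF this]
  show "\<epsilon>' b \<in> hom B b (fobj S' (fobj T' b))" "farr T' (\<epsilon>' b) = Ide Y (fobj T' b)"
    by (auto simp: \<epsilon>'_def)
qed

lemma cY_ide_iso: "y \<in> Ob Y \<Longrightarrow> is_iso Y (Ide Y y)"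
  using is_isoI[OF cY.ide_hom cY.ide_hom] cY.comp_ide_left[OF cY.ide_hom] by blast

lemma \<epsilon>'_iso: "b \<in> Ob B \<Longrightarrow> is_iso B (\<epsilon>' b)"
  using T'_reflects_iso[OF \<epsilon>'(1)] \<epsilon>'(2) cY_ide_iso[OF T'_ob] by simp

text \<open>
  On \<open>S'y = S'T'S'y\<close> the identity is an arrow with the defining property of \<open>\<epsilon>'\<close>.
\<close>

lemma \<epsilon>'_S': "y \<in> Ob Y \<Longrightarrow> \<epsilon>' (fobj S' y) = Ide B (fobj S' y)"
  using T'_faithful[OF \<epsilon>'(1)[OF S'_ob], of y] cB.ide_hom[OF S'_ob, of y]
  by (simp add: T'S'_ob \<epsilon>'(2)[OF S'_ob] T'_ide[OF S'_ob])

lemma S'T'_functor: "is_functor B B (S' \<cdot> T')"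
  using is_functor_fcomp[OF T'_functor S'_functor] by simp

lemma \<epsilon>'_natural: "nat_trans B B id_functor (S' \<cdot> T') \<epsilon>'"
proof (rule nat_transI[OF is_functor_id[OF category_B] S'T'_functor])
  show "\<epsilon>' b \<in> hom B (fobj id_functor b) (fobj (S' \<cdot> T') b)" if "b \<in> Ob B" for b
    using \<epsilon>'(1)[OF that] by simp
  fix F b c assume F: "F \<in> hom B b c"
  note bc = cB.hom_ob[OF F]
  note b = \<epsilon>'[OF bc(1)] and c = \<epsilon>'[OF bc(2)] and f = T'_hom[OF F]
  have "Comp B (farr S' (farr T' F)) (\<epsilon>' b) = Comp B (\<epsilon>' c) F"
    by (rule T'_faithful[OF cB.comp_hom[OF b(1) S'_hom[OF f]] cB.comp_hom[OF F c(1)]])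
      (simp add: T'_comp[OF b(1) S'_hom[OF f]] T'_comp[OF F c(1)] b(2) c(2) T'S'_arr
        cY.comp_ide_left[OF f] cY.comp_ide_right[OF f])
  then show "Comp B (farr (S' \<cdot> T') F) (\<epsilon>' b) = Comp B (\<epsilon>' c) (farr id_functor F)" by simp
qed

lemma lifted_dual_equivalence: "dual_equivalence B Y T' S' (Ide Y) \<epsilon>'"
proof -
  have \<eta>': "nat_trans Y Y id_functor (T' \<cdot> S') (Ide Y)"
    by (rule nat_transI[OF is_functor_id[OF cY.category_axioms]
          is_functor_fcomp[OF S'_functor T'_functor]])
      (auto simp: T'S'_ob T'S'_arr cY.ide_hom cY.comp_ide_left cY.comp_ide_right)
  have "farr T' (\<epsilon>' b) \<odot> Ide Y (fobj T' b) = Ide Y (fobj T' b)" if "b \<in> Ob B" for b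
    using \<epsilon>'(2)[OF that] cY.comp_ide_left[OF cY.ide_hom[OF T'_ob[OF that]]] by simp
  moreover have "Comp B (farr S' (Ide Y y)) (\<epsilon>' (fobj S' y)) = Ide B (fobj S' y)"
    if y: "y \<in> Ob Y" for y
    using is_functorD(5)[OF S'_functor y] cB.comp_ide_left[OF cB.ide_hom[OF S'_ob[OF y]]]
    by (simp add: \<epsilon>'_S'[OF y])
  ultimately show ?thesis
    using T'_functor S'_functor \<eta>' \<epsilon>'_natural cY_ide_iso \<epsilon>'_iso
    by (simp add: dual_equivalence_def dual_adjunction_def nat_iso_def)
qed

section \<open>The embedding and its reflector\<close>

lemma I_obj [simp]: "fobj I a = (a, Ide Y (fobj T a))"
  by (simp add: embedding_C_def)

lemma I_ob:
  assumes a: "a \<in> Ob A"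
  shows "fobj I a \<in> Ob B"
proof -
  note Ta = T_ob[OF a]
  have "\<pi> (fobj T a) \<odot> u (fobj T a) \<in> P"
    by (rule P_I[OF sub_ob[OF Ta] u_iso[OF Ta] homD(3)[OF u_hom[OF Ta]]])
  then show ?thesis
    using a homD(2)[OF cY.ide_hom[OF sub_ob[OF Ta]]] by (simp add: \<pi>_u[OF Ta] Ob_B_iff)
qed

lemma T'_I_ob: "a \<in> Ob A \<Longrightarrow> fobj T' (fobj I a) = fobj T a"
  using homD(3)[OF cY.ide_hom[OF sub_ob[OF T_ob]]] by simp

lemma I_arr: "\<phi> \<in> hom A a b \<Longrightarrow> farr I \<phi> = (fobj I a, (\<phi>, farr T \<phi>), fobj I b)"
  by (auto simp: embedding_C_def hom_def)

lemma I_hom: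
  assumes \<phi>: "\<phi> \<in> hom A a b"
  shows "farr I \<phi> \<in> hom B (fobj I a) (fobj I b)"
proof -
  note ab = cA.hom_ob[OF \<phi>]
  note T\<phi> = sub_hom[OF T_hom[OF \<phi>]]
  show ?thesis
    using I_ob[OF ab(1)] I_ob[OF ab(2)] T'_I_ob[OF ab(1)] T'_I_ob[OF ab(2)] \<phi> T\<phi>
      cY.comp_ide_left[OF T\<phi>] cY.comp_ide_right[OF T\<phi>]
    by (simp add: I_arr[OF \<phi>] hom_B_iff)
qed

lemma I_functor: "is_functor A B I"
proof (rule is_functorI[OF cA.category_axioms category_B I_ob I_hom])
  show "farr I (Ide A a) = Ide B (fobj I a)" if a: "a \<in> Ob A" for a
    using T'_I_ob[OF a]
    by (simp add: I_arr[OF cA.ide_hom[OF a]] T_ide[OF a] sub_ide[OF T_ob[OF a]])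
  show "farr I (Comp A \<psi> \<phi>) = Comp B (farr I \<psi>) (farr I \<phi>)"
    if \<phi>: "\<phi> \<in> hom A a b" and \<psi>: "\<psi> \<in> hom A b c" for \<phi> \<psi> a b c
    by (simp add: I_arr[OF cA.comp_hom[OF \<phi> \<psi>]] I_arr[OF \<phi>] I_arr[OF \<psi>] T_comp[OF \<phi> \<psi>]
        sub_comp[OF T_hom[OF \<psi>] T_hom[OF \<phi>]])
qed

text \<open>
  An arrow \<open>(\<phi>, f)\<close> between objects \<open>(a, 1)\<close> and \<open>(b, 1)\<close> satisfies \<open>1 \<circ> T\<phi> = f \<circ> 1\<close>.
\<close>

lemma I_full_embedding: "full_embedding A B I"
proof -
  have "bij_betw (farr I) (hom A a b) (hom B (fobj I a) (fobj I b))"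
    if a: "a \<in> Ob A" and b: "b \<in> Ob A" for a b
  proof (rule bij_betw_imageI)
    show "inj_on (farr I) (hom A a b)" by (rule inj_onI) (simp add: I_arr)
    show "farr I ` hom A a b = hom B (fobj I a) (fobj I b)"
    proof
      show "farr I ` hom A a b \<subseteq> hom B (fobj I a) (fobj I b)" using I_hom by blast
      show "hom B (fobj I a) (fobj I b) \<subseteq> farr I ` hom A a b"
      proof
        fix F assume F: "F \<in> hom B (fobj I a) (fobj I b)"
        obtain \<phi> f where f: "F = (fobj I a, (\<phi>, f), fobj I b)" "\<phi> \<in> hom A a b"
            "f \<in> hom Y (fobj T' (fobj I b)) (fobj T' (fobj I a))"
            "Ide Y (fobj T a) \<odot> farr T \<phi> = f \<odot> Ide Y (fobj T b)"
          using F by (auto simp: hom_B_iff)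
        have fh: "f \<in> hom Y (fobj T b) (fobj T a)"
          using f(3) by (simp only: T'_I_ob[OF a] T'_I_ob[OF b])
        have "f = farr T \<phi>"
          using f(4) cY.comp_ide_right[OF fh] cY.comp_ide_left[OF sub_hom[OF T_hom[OF f(2)]]]
          by simp
        then have "F = farr I \<phi>" by (simp add: f(1) I_arr[OF f(2)])
        then show "F \<in> farr I ` hom A a b" using f(2) by blast
      qed
    qed
  qed
  then show ?thesis
    using I_functor by (simp add: full_embedding_def inj_on_def)
qed

definition D :: "('a \<times> 'n, ('a, 'k, 'n) c_arr, 'a, 'k) ftor" where
  "D = \<lparr>fobj = fst, farr = (\<lambda>(b, (\<phi>, f), b'). \<phi>)\<rparr>"

lemma D_simps [simp]: "fobj D (a, p) = a" "farr D (b, (\<phi>, f), b') = \<phi>"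
  by (simp_all add: D_def)

lemma D_functor: "is_functor B A D"
proof (rule is_functorI[OF category_B cA.category_axioms])
  show "fobj D b \<in> Ob A" if "b \<in> Ob B" for b
    using that by (cases b) (simp add: Ob_B_iff)
  show "farr D F \<in> hom A (fobj D b) (fobj D c)" if "F \<in> hom B b c" for F b c
    using that by (cases b; cases c) (auto simp: hom_B_iff)
  show "farr D (Ide B b) = Ide A (fobj D b)" for b
    by (cases b) simp
  show "farr D (Comp B G F) = Comp A (farr D G) (farr D F)"
    if "F \<in> hom B b c" "G \<in> hom B c d" for F G b c d
    using that by (cases b; cases c; cases d) (auto simp: hom_B_iff)
qed

lemma D_ob: "b \<in> Ob B \<Longrightarrow> fobj D b \<in> Ob A"
  and D_hom: "F \<in> hom B b c \<Longrightarrow> farr D F \<in> hom A (fobj D b) (fobj D c)"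
  and D_ide: "b \<in> Ob B \<Longrightarrow> farr D (Ide B b) = Ide A (fobj D b)"
  using is_functorD(3-5)[OF D_functor] by auto

lemma D_I: "functor_eq A (D \<cdot> I) id_functor"
  by (auto simp: functor_eq_def I_arr[OF Arr_hom])

lemma D_S': "functor_eq Y (D \<cdot> S') (S \<cdot> E)"
  by (auto simp: functor_eq_def S'_def)

definition \<rho> :: "'a \<times> 'n \<Rightarrow> ('a, 'k, 'n) c_arr" where
  "\<rho> = (\<lambda>(a, p). ((a, p), (Ide A a, p), fobj I a))"

lemma \<rho>_hom:
  assumes b: "b \<in> Ob B"
  shows "\<rho> b \<in> hom B b (fobj I (fobj D b))"
proof -
  obtain a p where ap: "b = (a, p)" by force
  have a: "a \<in> Ob A" using b by (simp add: ap Ob_B_iff)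
  note p = Ob_B_hom(1)[OF b[unfolded ap]]
  have "p \<odot> farr T (Ide A a) = p \<odot> Ide Y (fobj T a)"
    by (simp add: T_ide[OF a] sub_ide[OF T_ob[OF a]])
  then show ?thesis
    using b I_ob[OF a] cA.ide_hom[OF a] p T'_I_ob[OF a] by (simp add: ap \<rho>_def hom_B_iff)
qed

lemma D_\<rho>: "farr D (\<rho> b) = Ide A (fobj D b)"
  by (cases b) (simp add: \<rho>_def)

lemma T'_\<rho>: "farr T' (\<rho> (a, p)) = p"
  by (simp add: \<rho>_def)

lemma \<rho>_I: "a \<in> Ob A \<Longrightarrow> \<rho> (fobj I a) = Ide B (fobj I a)"
  using T'_I_ob by (simp add: \<rho>_def)

text \<open>
  The counit is the identity, as \<open>DI = 1\<close>. Naturality of \<open>\<rho>\<close> at \<open>(\<phi>, f)\<close> is the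
  equation \<open>p \<circ> T\<phi> = f \<circ> p'\<close> that defines arrows of \<open>B\<close>.
\<close>

lemma reflector: "adjoint_with_unit B A D I \<rho>"
proof -
  have "nat_trans B B id_functor (I \<cdot> D) \<rho>"
  proof (rule nat_transI[OF is_functor_id[OF category_B] is_functor_fcomp[OF D_functor I_functor]])
    show "\<rho> b \<in> hom B (fobj id_functor b) (fobj (I \<cdot> D) b)" if "b \<in> Ob B" for b
      using \<rho>_hom[OF that] by simp
    fix F b c assume F: "F \<in> hom B b c"
    obtain a p a' p' where eqs: "b = (a, p)" "c = (a', p')" by (metis surj_pair)
    obtain \<phi> f where f: "F = ((a, p), (\<phi>, f), (a', p'))" "\<phi> \<in> hom A a a'"
        "p \<odot> farr T \<phi> = f \<odot> p'"
      using F unfolding eqs by (rule hom_B_E)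
    show "Comp B (farr (I \<cdot> D) F) (\<rho> b) = Comp B (\<rho> c) (farr id_functor F)"
      by (simp add: eqs f(1,3) \<rho>_def I_arr[OF f(2)] cA.comp_ide_left[OF f(2)]
          cA.comp_ide_right[OF f(2)])
  qed
  moreover have "nat_trans A A (D \<cdot> I) id_functor (Ide A)"
    by (rule nat_transI[OF is_functor_fcomp[OF I_functor D_functor]
          is_functor_id[OF cA.category_axioms]])
      (auto simp: I_arr cA.ide_hom cA.comp_ide_left cA.comp_ide_right)
  moreover have "Comp A (Ide A (fobj D b)) (farr D (\<rho> b)) = Ide A (fobj D b)" if "b \<in> Ob B" for b
    using cA.comp_ide_left[OF cA.ide_hom[OF D_ob[OF that]]] by (simp add: D_\<rho>)
  moreover have "Comp B (farr I (Ide A a)) (\<rho> (fobj I a)) = Ide B (fobj I a)" if a: "a \<in> Ob A" for a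
    using is_functorD(5)[OF I_functor a] cB.comp_ide_left[OF cB.ide_hom[OF I_ob[OF a]]] \<rho>_I[OF a]
    by simp
  ultimately have "adjunction B A D I \<rho> (Ide A)"
    using D_functor I_functor by (simp add: adjunction_def)
  then show ?thesis by (auto simp: adjoint_with_unit_def)
qed

lemma right_lift: "right_lifting A X T B Y T' I inclusion_functor"
  using I_functor J_functor T'_I_ob
  by (auto simp: right_lifting_def functor_eq_def I_arr[OF Arr_hom])

lemma left_lift: "left_lifting B Y S' A X S D E"
  using D_functor E_functor D_S' by (auto simp: left_lifting_def functor_eq_def)

section \<open>The canonical isomorphisms\<close>

definition \<gamma> :: "'y \<Rightarrow> ('a, 'k, 'n) c_arr" where
  "\<gamma> = canonical_right B I inclusion_functor S \<eta> S' \<epsilon>'"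

text \<open>
  \<open>T'\<epsilon>' = 1\<close> and \<open>T'S' = 1\<close> give \<open>T'\<gamma> = \<eta>\<close>; as \<open>T'\<close> is fully faithful, \<open>\<gamma>\<close> inherits naturality
  and invertibility from \<open>\<eta>\<close>.
\<close>

lemma \<gamma>:
  assumes x: "x \<in> Ob X"
  shows "\<gamma> x \<in> hom B (fobj I (fobj S x)) (fobj S' x)" "farr T' (\<gamma> x) = \<eta> x"
proof -
  note Sx = S_ob[OF x]
  note IS = I_ob[OF Sx] and h = sub_hom[OF \<eta>_hom[OF x]]
  have e: "\<epsilon>' (fobj I (fobj S x)) \<in> hom B (fobj I (fobj S x)) (fobj S' (fobj T (fobj S x)))"
      "farr T' (\<epsilon>' (fobj I (fobj S x))) = Ide Y (fobj T (fobj S x))"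
    using \<epsilon>'[OF IS] unfolding T'_I_ob[OF Sx] by blast+
  show "\<gamma> x \<in> hom B (fobj I (fobj S x)) (fobj S' x)"
    using cB.comp_hom[OF e(1) S'_hom[OF h]] by (simp add: \<gamma>_def canonical_right_def)
  show "farr T' (\<gamma> x) = \<eta> x"
    using T'_comp[OF e(1) S'_hom[OF h]] e(2) cY.comp_ide_left[OF h]
    by (simp add: \<gamma>_def canonical_right_def T'S'_arr)
qed

lemma iso_X_Y:
  assumes f: "f \<in> hom X x y" and iso: "is_iso X f"
  shows "is_iso Y f"
proof -
  note xy = cX.hom_ob[OF f]
  obtain g where g: "g \<in> hom X y x" "Comp X g f = Ide X x" "Comp X f g = Ide X y"
    using is_isoE[OF iso f] by blast
  show ?thesis
    using is_isoI[OF sub_hom[OF f] sub_hom[OF g(1)]] g(2,3)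
    by (simp add: sub_comp[OF f g(1)] sub_comp[OF g(1) f] sub_ide[OF xy(1)] sub_ide[OF xy(2)])
qed

lemma \<gamma>_nat_iso: "nat_iso (op X) B (I \<cdot> S) (S' \<cdot> inclusion_functor) \<gamma>"
proof -
  have "is_functor (op X) B (I \<cdot> S)"
    using is_functor_fcomp[OF _ I_functor] S_functor by (simp add: is_functor_op_shift)
  moreover have "is_functor (op X) B (S' \<cdot> inclusion_functor)"
    using is_functor_fcomp[OF J_functor S'_functor] by (simp add: is_functor_op_shift)
  ultimately have "nat_trans (op X) B (I \<cdot> S) (S' \<cdot> inclusion_functor) \<gamma>"
  proof (rule nat_transI)
    show "\<gamma> x \<in> hom B (fobj (I \<cdot> S) x) (fobj (S' \<cdot> inclusion_functor) x)" if "x \<in> Ob (op X)" for x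
      using \<gamma>(1)[of x] that by simp
    fix f y x assume "f \<in> hom (op X) y x"
    then have f: "f \<in> hom X x y" by simp
    note xy = cX.hom_ob[OF f]
    note gx = \<gamma>[OF xy(1)] and gy = \<gamma>[OF xy(2)]
    note ISf = I_hom[OF S_hom[OF f]] and S'f = S'_hom[OF sub_hom[OF f]]
    have "farr T' (farr I (farr S f)) = farr T (farr S f)"
      by (simp add: I_arr[OF S_hom[OF f]])
    then have "farr T' (Comp B (farr S' f) (\<gamma> y)) = farr T' (Comp B (\<gamma> x) (farr I (farr S f)))"
      using \<eta>_natural[OF f]
      by (simp only: T'_comp[OF gy(1) S'f] T'_comp[OF ISf gx(1)] gx(2) gy(2) T'S'_arr
          sub_comp[OF f \<eta>_hom[OF xy(2)]] sub_comp[OF \<eta>_hom[OF xy(1)] T_hom[OF S_hom[OF f]]])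
    then have "Comp B (farr S' f) (\<gamma> y) = Comp B (\<gamma> x) (farr I (farr S f))"
      by (rule T'_faithful[OF cB.comp_hom[OF gy(1) S'f] cB.comp_hom[OF ISf gx(1)]])
    then show "Comp B (farr (S' \<cdot> inclusion_functor) f) (\<gamma> y) = Comp B (\<gamma> x) (farr (I \<cdot> S) f)"
      by simp
  qed
  moreover have "is_iso B (\<gamma> x)" if x: "x \<in> Ob X" for x
    using T'_reflects_iso[OF \<gamma>(1)[OF x]] iso_X_Y[OF \<eta>_hom[OF x] \<eta>_iso[OF x]] \<gamma>(2)[OF x] by simp
  ultimately show ?thesis by (simp add: nat_iso_def)
qed

text \<open>
  The image of the equation under \<open>T'\<close> is \<open>p\<^sub>y \<circ> \<eta>\<^bsub>Ey\<^esub> = \<pi>\<^sub>y\<close>, the equation defining \<open>p\<^sub>y\<close>.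
\<close>

lemma \<gamma>_\<rho>:
  assumes y: "y \<in> Ob Y"
  shows "Comp B (\<gamma> (fobj E y)) (\<rho> (fobj S' y)) = farr S' (\<pi> y)"
proof -
  have r: "\<rho> (fobj S' y) \<in> hom B (fobj S' y) (fobj I (fobj S (fobj E y)))"
    using \<rho>_hom[OF S'_ob[OF y]] by (simp add: S'_def)
  have "farr T' (\<rho> (fobj S' y)) = proj y" by (simp add: S'_def T'_\<rho>)
  then show ?thesis
    using T'_faithful[OF cB.comp_hom[OF r \<gamma>(1)[OF E_ob[OF y]]] S'_hom[OF \<pi>_hom[OF y]]] proj(3)[OF y]
    by (simp add: T'_comp[OF r \<gamma>(1)[OF E_ob[OF y]]] \<gamma>(2)[OF E_ob[OF y]] T'S'_arr)
qed

definition \<beta> :: "'a \<times> 'n \<Rightarrow> 'n" where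
  "\<beta> = canonical_left X D E T' \<epsilon>' T \<eta>"

lemma D_\<epsilon>'_hom:
  assumes b: "b \<in> Ob B"
  shows "farr D (\<epsilon>' b) \<in> hom A (fobj D b) (fobj S (fobj E (fobj T' b)))"
  using D_hom[OF \<epsilon>'(1)[OF b]] by (simp add: S'_def)

lemma \<beta>_eq: "\<beta> b = Comp X (farr T (farr D (\<epsilon>' b))) (\<eta> (fobj E (fobj T' b)))"
  by (simp add: \<beta>_def canonical_left_def)

lemma \<beta>_hom:
  assumes b: "b \<in> Ob B"
  shows "\<beta> b \<in> hom X (fobj E (fobj T' b)) (fobj T (fobj D b))"
  unfolding \<beta>_eq by (rule cX.comp_hom[OF \<eta>_hom[OF E_ob[OF T'_ob[OF b]]] T_hom[OF D_\<epsilon>'_hom[OF b]]])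

text \<open>
  Write \<open>b = (a, p)\<close> and \<open>\<epsilon>'\<^sub>b = (\<phi>, 1)\<close>. Since \<open>\<epsilon>'\<^sub>b\<close> is an arrow of \<open>B\<close>, \<open>p \<circ> T\<phi> = p\<^sub>y\<close>, and
  hence \<open>p \<circ> \<beta>\<^sub>b = p \<circ> T\<phi> \<circ> \<eta>\<^bsub>Ey\<^esub> = p\<^sub>y \<circ> \<eta>\<^bsub>Ey\<^esub> = \<pi>\<^sub>y\<close>.
\<close>

lemma \<rho>_\<beta>:
  assumes b: "b \<in> Ob B"
  shows "farr T' (\<rho> b) \<odot> \<beta> b = \<pi> (fobj T' b)"
proof -
  obtain a p where ap: "b = (a, p)" by force
  define y where "y = fobj T' b"
  have y: "y \<in> Ob Y" unfolding y_def by (rule T'_ob[OF b])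
  have S'y: "fobj S' y = (fobj S (fobj E y), proj y)" by (simp add: S'_def)
  have "\<epsilon>' b \<in> hom B (a, p) (fobj S (fobj E y), proj y)"
    using \<epsilon>'(1)[OF b] S'y by (simp add: ap y_def)
  then obtain \<phi> f where e: "\<epsilon>' b = ((a, p), (\<phi>, f), (fobj S (fobj E y), proj y))"
      "\<phi> \<in> hom A a (fobj S (fobj E y))" "p \<odot> farr T \<phi> = f \<odot> proj y"
    by (rule hom_B_E)
  have f: "f = Ide Y y" using \<epsilon>'(2)[OF b] by (simp add: e(1) y_def)
  note pr = Ob_B_hom(1)[OF proj(1)[OF y], unfolded proj(2)[OF y]]
  note p = Ob_B_hom(1)[OF b[unfolded ap]]
  note T\<phi> = T_hom[OF e(2)] and h = \<eta>_hom[OF E_ob[OF y]]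
  have "\<beta> b = farr T \<phi> \<odot> \<eta> (fobj E y)"
    by (simp add: \<beta>_eq e(1) sub_comp[OF h T\<phi>] flip: y_def)
  then have "farr T' (\<rho> b) \<odot> \<beta> b = (p \<odot> farr T \<phi>) \<odot> \<eta> (fobj E y)"
    using cY.comp_assoc[OF sub_hom[OF h] sub_hom[OF T\<phi>] p] by (simp add: ap T'_\<rho>)
  also have "\<dots> = \<pi> y"
    by (simp add: e(3) f cY.comp_ide_left[OF pr] proj(3)[OF y])
  finally show ?thesis by (simp add: y_def)
qed

lemma ET'_functor: "is_functor (op B) X (E \<cdot> T')"
  by (rule is_functor_fcomp[OF T'_functor E_functor])

lemma TD_functor: "is_functor (op B) X (T \<cdot> D)"
  using is_functor_fcomp[of "op B" "op A" D, OF _ T_functor] D_functor by simp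

text \<open>
  After composition with \<open>p\<close>, both sides of the naturality square become \<open>f \<circ> \<pi>\<close>, by
  \<open>\<rho>_\<beta>\<close> and naturality of \<open>\<pi>\<close>; and \<open>p\<close> can be cancelled.
\<close>

lemma \<beta>_nat_trans: "nat_trans (op B) X (E \<cdot> T') (T \<cdot> D) \<beta>"
proof (rule nat_transI[OF ET'_functor TD_functor])
  show "\<beta> b \<in> hom X (fobj (E \<cdot> T') b) (fobj (T \<cdot> D) b)" if "b \<in> Ob (op B)" for b
    using \<beta>_hom[of b] that by simp
  fix F c b assume "F \<in> hom (op B) c b"
  then have F: "F \<in> hom B b c" by simp
  note bc = cB.hom_ob[OF F]
  obtain a p a' p' where eqs: "b = (a, p)" "c = (a', p')" by (metis surj_pair)
  obtain \<phi> f where f: "F = ((a, p), (\<phi>, f), (a', p'))"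
      "\<phi> \<in> hom A a a'" "f \<in> hom Y (Cod Y p') (Cod Y p)" "p \<odot> farr T \<phi> = f \<odot> p'"
    using F unfolding eqs by (rule hom_B_E)
  note p = Ob_B_hom(1)[OF bc(1)[unfolded eqs]] and p' = Ob_B_hom(1)[OF bc(2)[unfolded eqs]]
  note Bb = \<beta>_hom[OF bc(1), unfolded eqs, simplified]
    and Bc = \<beta>_hom[OF bc(2), unfolded eqs, simplified]
  note pb = \<rho>_\<beta>[OF bc(1), unfolded eqs, simplified T'_\<rho> T'_simps]
    and pc = \<rho>_\<beta>[OF bc(2), unfolded eqs, simplified T'_\<rho> T'_simps]
  note T\<phi> = T_hom[OF f(2)] and Ef = E_hom[OF f(3)]
  note l = cX.comp_hom[OF Bc T\<phi>] and r = cX.comp_hom[OF Ef Bb]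
  have "p \<odot> Comp X (farr T \<phi>) (\<beta> (a', p')) = (p \<odot> farr T \<phi>) \<odot> \<beta> (a', p')"
    using cY.comp_assoc[OF sub_hom[OF Bc] sub_hom[OF T\<phi>] p] by (simp add: sub_comp[OF Bc T\<phi>])
  also have "\<dots> = f \<odot> \<pi> (Cod Y p')"
    using cY.comp_assoc[OF sub_hom[OF Bc] p' f(3)] by (simp add: f(4) pc)
  also have "\<dots> = \<pi> (Cod Y p) \<odot> farr E f" by (rule \<pi>_natural[OF f(3), symmetric])
  also have "\<dots> = p \<odot> Comp X (\<beta> (a, p)) (farr E f)"
    using cY.comp_assoc[OF sub_hom[OF Ef] sub_hom[OF Bb] p] by (simp add: sub_comp[OF Ef Bb] pb)
  finally have "Comp X (farr T \<phi>) (\<beta> (a', p')) = Comp X (\<beta> (a, p)) (farr E f)"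
    using P_cancel[of p, OF _ cX.hom_ob(1)[OF l]] l r bc(1) by (simp add: eqs Ob_B_iff)
  then show "Comp X (farr (T \<cdot> D) F) (\<beta> c) = Comp X (\<beta> b) (farr (E \<cdot> T') F)"
    by (simp add: eqs f(1))
qed

text \<open>
  If \<open>p = \<pi>\<^sub>y \<circ> \<alpha>\<close>, then \<open>\<alpha>\<close> is inverse to \<open>\<beta>\<close>, because \<open>\<alpha>\<close> and \<open>\<beta>\<close> compare the same two
  coreflections \<open>p\<close> and \<open>\<pi>\<^sub>y\<close> in opposite directions.
\<close>

lemma \<beta>_iso:
  assumes b: "b \<in> Ob B"
  shows "is_iso X (\<beta> b)"
proof -
  obtain a p where ap: "b = (a, p)" by force
  obtain y \<alpha> \<alpha>' where y: "y \<in> Ob Y" "p \<in> hom Y (Dom Y p) y"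
    and \<alpha>: "\<alpha> \<in> hom X (Dom Y p) (fobj E y)" and p\<alpha>: "p = \<pi> y \<odot> \<alpha>"
    using P_E[of p] b by (metis ap Ob_B_iff)
  have p: "p \<in> P" "Dom Y p = fobj T a" using b by (auto simp: ap Ob_B_iff)
  have cod: "Cod Y p = y" using y(2) by (simp add: hom_def)
  note pY = y(2)[unfolded p(2)] and \<alpha>Y = sub_hom[OF \<alpha>[unfolded p(2)]]
  have B: "\<beta> b \<in> hom X (fobj E y) (fobj T a)" using \<beta>_hom[OF b] by (simp add: ap cod)
  note BY = sub_hom[OF B] and \<alpha>X = \<alpha>[unfolded p(2)]
  note obs = cX.hom_ob[OF B]
  have pB: "p \<odot> \<beta> b = \<pi> y" using \<rho>_\<beta>[OF b] by (simp add: ap T'_\<rho> cod)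
  have "\<pi> y \<odot> (\<alpha> \<odot> \<beta> b) = \<pi> y \<odot> Ide Y (fobj E y)"
    using cY.comp_assoc[OF BY \<alpha>Y \<pi>_hom[OF y(1)]] pB
    by (simp add: p\<alpha>[symmetric] cY.comp_ide_right[OF \<pi>_hom[OF y(1)]])
  then have 1: "\<alpha> \<odot> \<beta> b = Ide Y (fobj E y)"
    by (rule \<pi>_cancel[OF y(1) obs(1) cY.comp_hom[OF BY \<alpha>Y] cY.ide_hom[OF sub_ob[OF obs(1)]]])
  have "p \<odot> (\<beta> b \<odot> \<alpha>) = p \<odot> Ide Y (fobj T a)"
    using cY.comp_assoc[OF \<alpha>Y BY pY] by (simp add: pB p\<alpha>[symmetric] cY.comp_ide_right[OF pY])
  then have 2: "Comp X (\<beta> b) \<alpha> = Ide X (fobj T a)"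
    using P_cancel[OF p(1) obs(2), of "Comp X (\<beta> b) \<alpha>" "Ide X (fobj T a)"]
      cX.comp_hom[OF \<alpha>X B] cX.ide_hom[OF obs(2)]
    by (simp add: p(2) sub_comp[OF \<alpha>X B] sub_ide[OF obs(2)])
  show ?thesis
    using is_isoI[OF B \<alpha>X] 1 2 by (simp add: sub_comp[OF B \<alpha>X] sub_ide[OF obs(1)])
qed

lemma \<beta>_S':
  assumes y: "y \<in> Ob Y"
  shows "\<beta> (fobj S' y) = \<eta> (fobj E y)"
proof -
  note Ey = E_ob[OF y]
  have "farr D (\<epsilon>' (fobj S' y)) = Ide A (fobj S (fobj E y))"
    using D_ide[OF S'_ob[OF y]] by (simp add: \<epsilon>'_S'[OF y]) (simp add: S'_def)
  then show ?thesis
    by (simp add: \<beta>_eq T'S'_ob[OF y] T_ide[OF S_ob[OF Ey]] cX.comp_ide_left[OF \<eta>_hom[OF Ey]])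
qed

text \<open>
  Naturality at \<open>\<epsilon>'\<^sub>b : b \<rightarrow> S'T'b\<close> expresses \<open>\<beta>'\<close> at \<open>b\<close> by \<open>\<beta>'\<close> at \<open>S'T'b\<close>, because
  \<open>ET'\<epsilon>'\<close> is the identity.
\<close>

lemma determined_on_S':
  assumes \<beta>': "nat_trans (op B) X (E \<cdot> T') (T \<cdot> D) \<beta>'"
    and on_S': "\<And>y. y \<in> Ob Y \<Longrightarrow> \<beta>' (fobj S' y) = \<eta> (fobj E y)" and b: "b \<in> Ob B"
  shows "\<beta>' b = \<beta> b"
proof -
  note y = T'_ob[OF b]
  have "\<epsilon>' b \<in> hom (op B) (fobj S' (fobj T' b)) b" using \<epsilon>'(1)[OF b] by simp
  from nat_transD(2)[OF \<beta>' this]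
  have "\<beta> b = Comp X (\<beta>' b) (farr E (farr T' (\<epsilon>' b)))"
    by (simp add: \<beta>_eq on_S'[OF y])
  also have "\<dots> = \<beta>' b"
    using nat_transD(1)[OF \<beta>', of b] b cX.comp_ide_right
    by (simp add: \<epsilon>'(2)[OF b] E_ide[OF y])
  finally show ?thesis by simp
qed

text \<open>
  By definition \<open>\<beta>\<^sub>b\<close> is the transpose of \<open>D\<epsilon>'\<^sub>b : Db \<rightarrow> SET'b\<close>.
\<close>

lemma transpose_iff:
  assumes b: "b \<in> Ob B" and g: "g \<in> hom X (fobj E (fobj T' b)) (fobj T (fobj D b))"
  shows "Comp A (farr S g) (\<epsilon> (fobj D b)) = farr D (\<epsilon>' b) \<longleftrightarrow> g = \<beta> b"
  using transpose_left[OF D_ob[OF b] g]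
    transpose_right[OF E_ob[OF T'_ob[OF b]] D_\<epsilon>'_hom[OF b]]
  by (auto simp: \<beta>_eq)

end

theorem corollary3p7:
  fixes A :: "('a, 'k) cat"
    and X Y :: "('y, 'n) cat"
    and B :: "('a \<times> 'n, ('a, 'k, 'n) c_arr) cat"
    and T :: "('a, 'k, 'y, 'n) ftor"
    and S :: "('y, 'n, 'a, 'k) ftor"
    and J E :: "('y, 'n, 'y, 'n) ftor"
    and I :: "('a, 'k, 'a \<times> 'n, ('a, 'k, 'n) c_arr) ftor"
    and \<eta> \<pi> :: "'y \<Rightarrow> 'n"
    and \<epsilon> :: "'a \<Rightarrow> 'k"
  assumes "full_subcategory X Y"
    and "J = inclusion_functor"
    and "adjoint_with_counit X Y J E \<pi>"
    and "dual_equivalence A X T S \<eta> \<epsilon>"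
    and "B = cat_C A Y T (P_class X Y E \<pi>)"
    and "I = embedding_C A Y T"
  shows "\<exists>T' S' \<eta>' \<epsilon>'.
    dual_equivalence B Y T' S' \<eta>' \<epsilon>' \<and>
    right_lifting A X T B Y T' I J \<and>
    functor_eq Y (T' \<cdot> S') id_functor \<and>
    (\<forall>y \<in> Ob Y. \<eta>' y = Ide Y y) \<and>
    (\<forall>b \<in> Ob B. farr T' (\<epsilon>' b) = Ide Y (fobj T' b)) \<and>
    (\<forall>y \<in> Ob Y. \<epsilon>' (fobj S' y) = Ide B (fobj S' y)) \<and>
    full_embedding A B I \<and>
    (\<exists>D \<rho>.
      adjoint_with_unit B A D I \<rho> \<and>
      functor_eq A (D \<cdot> I) id_functor \<and>
      (\<forall>a \<in> Ob A. \<rho> (fobj I a) = Ide B (fobj I a)) \<and>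
      functor_eq Y (D \<cdot> S') (S \<cdot> E) \<and>
      left_lifting B Y S' A X S D E \<and>
      (let \<gamma> = canonical_right B I J S \<eta> S' \<epsilon>';
           \<beta> = canonical_left X D E T' \<epsilon>' T \<eta>
       in nat_iso (op X) B (I \<cdot> S) (S' \<cdot> J) \<gamma> \<and>
          nat_iso (op B) X (E \<cdot> T') (T \<cdot> D) \<beta> \<and>
          (\<forall>\<beta>'. nat_trans (op B) X (E \<cdot> T') (T \<cdot> D) \<beta>' \<longrightarrow>
             ((\<forall>y \<in> Ob Y. \<beta>' (fobj S' y) = \<eta> (fobj E y)) \<longleftrightarrow> (\<forall>b \<in> Ob B. \<beta>' b = \<beta> b)) \<and>
             ((\<forall>b \<in> Ob B. Comp A (farr S (\<beta>' b)) (\<epsilon> (fobj D b)) = farr D (\<epsilon>' b))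
                \<longleftrightarrow> (\<forall>b \<in> Ob B. \<beta>' b = \<beta> b))) \<and>
          (\<forall>b \<in> Ob B. Comp Y (farr T' (\<rho> b)) (farr J (\<beta> b)) = \<pi> (fobj T' b)) \<and>
          (\<forall>y \<in> Ob Y. Comp B (\<gamma> (fobj E y)) (\<rho> (fobj S' y)) = farr S' (\<pi> y))))"
proof -
  obtain u where u: "adjunction X Y inclusion_functor E u \<pi>"
    using assms(2,3) by (auto simp: adjoint_with_counit_def)
  have cats: "category X" "category Y" "category A"
    using assms(1,4)
    by (auto simp: full_subcategory_def dual_equivalence_def dual_adjunction_def is_functor_def)
  interpret L: coreflective_dual_equiv A X Y T S \<eta> \<epsilon> E u \<pi>
    using cats assms(1,4) u
    by (simp add: coreflective_dual_equiv_def coreflective_dual_equiv_axioms_def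
        dual_equiv_def dual_equiv_axioms_def)
  have B: "cat_C A Y T (P_class X Y E \<pi>) = B" and I: "embedding_C A Y T = I"
    using assms(5,6) by auto
  note J = assms(2)[symmetric]
  have T'S': "functor_eq Y (L.T' \<cdot> L.S') id_functor"
    by (auto simp: functor_eq_def L.T'S'_ob L.T'S'_arr)
  have unique: "((\<forall>y \<in> Ob Y. \<beta>' (fobj L.S' y) = \<eta> (fobj E y)) \<longleftrightarrow> (\<forall>b \<in> Ob B. \<beta>' b = L.\<beta> b)) \<and>
      ((\<forall>b \<in> Ob B. Comp A (farr S (\<beta>' b)) (\<epsilon> (fobj L.D b)) = farr L.D (L.\<epsilon>' b))
         \<longleftrightarrow> (\<forall>b \<in> Ob B. \<beta>' b = L.\<beta> b))"
    if \<beta>': "nat_trans (op B) X (E \<cdot> L.T') (T \<cdot> L.D) \<beta>'" for \<beta>'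
  proof
    show "(\<forall>y \<in> Ob Y. \<beta>' (fobj L.S' y) = \<eta> (fobj E y)) \<longleftrightarrow> (\<forall>b \<in> Ob B. \<beta>' b = L.\<beta> b)"
      using L.determined_on_S'[unfolded B, OF \<beta>'] L.\<beta>_S' L.S'_ob[unfolded B] by metis
    have "\<beta>' b \<in> hom X (fobj E (fobj L.T' b)) (fobj T (fobj L.D b))" if "b \<in> Ob B" for b
      using nat_transD(1)[OF \<beta>', of b] that by simp
    then show "(\<forall>b \<in> Ob B. Comp A (farr S (\<beta>' b)) (\<epsilon> (fobj L.D b)) = farr L.D (L.\<epsilon>' b))
         \<longleftrightarrow> (\<forall>b \<in> Ob B. \<beta>' b = L.\<beta> b)"
      using L.transpose_iff[unfolded B] by simp
  qed
  have \<beta>: "nat_iso (op B) X (E \<cdot> L.T') (T \<cdot> L.D) L.\<beta>"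
    using L.\<beta>_nat_trans L.\<beta>_iso by (simp add: nat_iso_def B)
  have \<rho>\<beta>: "\<forall>b \<in> Ob B. Comp Y (farr L.T' (L.\<rho> b)) (farr J (L.\<beta> b)) = \<pi> (fobj L.T' b)"
    using L.\<rho>_\<beta> by (simp add: B assms(2))
  have canonical: "L.\<gamma> = canonical_right B I J S \<eta> L.S' L.\<epsilon>'"
      "L.\<beta> = canonical_left X L.D E L.T' L.\<epsilon>' T \<eta>"
    by (simp_all add: L.\<gamma>_def L.\<beta>_def B I J)
  show ?thesis
  proof (rule exI[of _ L.T'], rule exI[of _ L.S'], rule exI[of _ "Ide Y"], rule exI[of _ L.\<epsilon>'],
      intro conjI exI[of _ L.D] exI[of _ L.\<rho>])
    show "dual_equivalence B Y L.T' L.S' (Ide Y) L.\<epsilon>'"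
      by (rule L.lifted_dual_equivalence[unfolded B])
    show "right_lifting A X T B Y L.T' I J"
      by (rule L.right_lift[unfolded B I J])
    show "full_embedding A B I"
      by (rule L.I_full_embedding[unfolded B I])
    show "adjoint_with_unit B A L.D I L.\<rho>"
      by (rule L.reflector[unfolded B I])
    show "left_lifting B Y L.S' A X S L.D E"
      by (rule L.left_lift[unfolded B])
  qed (use T'S' L.\<epsilon>'(2)[unfolded B] L.\<epsilon>'_S'[unfolded B] L.D_I[unfolded I] L.\<rho>_I[unfolded B I] L.D_S'
      L.\<gamma>_nat_iso[unfolded B I J] \<beta> unique \<rho>\<beta> L.\<gamma>_\<rho>[unfolded B]
      in \<open>auto simp: Let_def simp flip: canonical\<close>)
qed

end
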